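(* Let $\omega>0$ and let $r$ be an $n\times n$-matrix whose entries are $\omega$-periodic distributions of order $0$ on $\mathbb{R}$ such that the matrices $\mathbb{1}\pm\frac12\Delta_r(x)$ are invertible for every $x\in\mathbb{R}$. Let the Jordan normal form of a monodromy matrix of $u'=ru$ have $s$ Jordan blocks, the $k$-th of which has size $\mu_k$ and eigenvalue $\rho_k$ ($k=1,\dots,s$), so that $\sum_{k=1}^s\mu_k=n$ and every $\rho_k\neq0$. Then the differential equation $u'=ru$ has a fundamental system of solutions of the form $$\mathrm{e}^{\alpha_k x}\sum_{j=0}^{\ell} q_{k,j}(x)\,p_{k,\ell-j}(x)\quad\text{for } \ell=0,\dots,\mu_k-1 \text{ and } k=1,\dots,s,$$ where $\mathrm{e}^{\alpha_k\omega}=\rho_k$, $q_{k,0}(x)=1$, $q_{k,j+1}(x)=q_{k,j}(x)\dfrac{x-j\omega}{(j+1)\rho_k\omega}$, and the $p_{k,j}$ are balanced, $\mathbb{C}^n$-valued functions which are periodic with period $\omega$.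
   Context: A distribution on $\mathbb{R}$ is of order $0$ if for every compact $K\subset\mathbb{R}$ there is $C\ge0$ such that $|r(\phi)|\le C\|\phi\|_\infty$ for all test functions ($C^\infty$, compactly supported) $\phi$ supported in $K$; it is identified with a local complex measure $dR$, where $R:\mathbb{R}\to\mathbb{C}$ is of locally bounded variation and $r(\phi)=\int\phi\,dR$. It is $\omega$-periodic if $r(\phi)=r(\phi(\cdot+\omega))$ for all test functions $\phi$. For a matrix $r$ of such distributions with antiderivative $R$ put $\Delta_r(x)=R^+(x)-R^-(x)$, where $R^\pm$ are the right- and left-hand limits; $\mathbb{1}$ is the identity matrix. For $f\in L^1_{\rm loc}(|dR|)$ the product $rf$ is the distribution $\phi\mapsto\int f\phi\,dR$ (extended to matrix-vector products). A function $f$ of locally bounded variation is balanced if $f=(f^++f^-)/2$. Solutions of $u'=ru$ are balanced $\mathbb{C}^n$-valued functions of locally bounded variation satisfying the equation in the sense of distributions. Under the stated invertibility assumption, initial value problems have unique balanced solutions, the solution space is $n$-dimensional, and a fundamental matrix $U$ (an $n\times n$-matrix whose columns form a basis of the solution space, i.e. a fundamental system of solutions) satisfies $U(x+\omega)=U(x)M$ for a constant invertible matrix $M$, called a monodromy matrix; monodromy matrices for different choices of $U$ are similar. A Jordan block with eigenvalue $\rho$ has $\rho$ on the diagonal and $1$ on the first superdiagonal. *)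

theory Defs
  imports "HOL-Analysis.Analysis" "Jordan_Normal_Form.Jordan_Normal_Form"
begin

no_notation Finite_Cartesian_Product.vec_nth (infixl \<open>$\<close> 90)

definition smooth :: "(real \<Rightarrow> complex) \<Rightarrow> bool" where
  "smooth \<phi> \<longleftrightarrow>
     (\<forall>k x. ((\<lambda>g y. vector_derivative g (at y)) ^^ k) \<phi> differentiable (at x))"

definition supp :: "(real \<Rightarrow> complex) \<Rightarrow> real set" where
  "supp \<phi> = closure {x. \<phi> x \<noteq> 0}"

definition test_function :: "(real \<Rightarrow> complex) \<Rightarrow> bool" where
  "test_function \<phi> \<longleftrightarrow> smooth \<phi> \<and> compact (supp \<phi>)"

text \<open>A functional on test functions is represented by a function on all of
  \<open>real \<Rightarrow> complex\<close>; only its values on test functions are ever used.\<close>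

type_synonym functional = "(real \<Rightarrow> complex) \<Rightarrow> complex"

text \<open>Continuity, which is part of the notion of a distribution, is implied by the bounds.\<close>

definition distribution_order0 :: "functional \<Rightarrow> bool" where
  "distribution_order0 r \<longleftrightarrow>
     (\<forall>\<phi> \<psi>. test_function \<phi> \<longrightarrow> test_function \<psi> \<longrightarrow> r (\<lambda>x. \<phi> x + \<psi> x) = r \<phi> + r \<psi>) \<and>
     (\<forall>c \<phi>. test_function \<phi> \<longrightarrow> r (\<lambda>x. c * \<phi> x) = c * r \<phi>) \<and>
     (\<forall>K. compact K \<longrightarrow>
        (\<exists>C\<ge>0. \<forall>\<phi>. test_function \<phi> \<longrightarrow> supp \<phi> \<subseteq> K \<longrightarrow>
           cmod (r \<phi>) \<le> C * (SUP x. cmod (\<phi> x))))"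

definition periodic_distribution :: "real \<Rightarrow> functional \<Rightarrow> bool" where
  "periodic_distribution \<omega> r \<longleftrightarrow> (\<forall>\<phi>. test_function \<phi> \<longrightarrow> r \<phi> = r (\<lambda>x. \<phi> (x + \<omega>)))"

definition variation_sums :: "(real \<Rightarrow> 'a::real_normed_vector) \<Rightarrow> real \<Rightarrow> real \<Rightarrow> real set" where
  "variation_sums f a b =
     {(\<Sum>i<m. norm (f (t (Suc i)) - f (t i))) | (m::nat) t. mono t \<and> range t \<subseteq> {a..b}}"

definition variation :: "(real \<Rightarrow> 'a::real_normed_vector) \<Rightarrow> real \<Rightarrow> real \<Rightarrow> real" where
  "variation f a b = Sup (variation_sums f a b)"

definition locally_bv :: "(real \<Rightarrow> 'a::real_normed_vector) \<Rightarrow> bool" where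
  "locally_bv f \<longleftrightarrow> (\<forall>a b. bdd_above (variation_sums f a b))"

definition right_lim :: "(real \<Rightarrow> 'a::t2_space) \<Rightarrow> real \<Rightarrow> 'a" where
  "right_lim f x = Lim (at_right x) f"

definition left_lim :: "(real \<Rightarrow> 'a::t2_space) \<Rightarrow> real \<Rightarrow> 'a" where
  "left_lim f x = Lim (at_left x) f"

definition balanced :: "(real \<Rightarrow> complex) \<Rightarrow> bool" where
  "balanced f \<longleftrightarrow> locally_bv f \<and> (\<forall>x. f x = (right_lim f x + left_lim f x) / 2)"

definition balanced_vec :: "nat \<Rightarrow> (real \<Rightarrow> complex vec) \<Rightarrow> bool" where
  "balanced_vec n f \<longleftrightarrow> (\<forall>x. f x \<in> carrier_vec n) \<and> (\<forall>i<n. balanced (\<lambda>x. f x $ i))"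

text \<open>The signed measure \<open>dG\<close> satisfies \<open>dG (a, b] = G\<^sup>+ b - G\<^sup>+ a\<close>. Its Jordan
  decomposition is obtained from the variation \<open>V\<close> of the right-continuous function
  \<open>G\<^sup>+\<close>, normalised by \<open>V 0 = 0\<close>: the functions \<open>(V + G\<^sup>+) / 2\<close> and \<open>(V - G\<^sup>+) / 2\<close>
  are non-decreasing and right-continuous.\<close>

definition cumulative_variation :: "(real \<Rightarrow> real) \<Rightarrow> real \<Rightarrow> real" where
  "cumulative_variation F x = (if 0 \<le> x then variation F 0 x else - variation F x 0)"

definition pos_measure :: "(real \<Rightarrow> real) \<Rightarrow> real measure" where
  "pos_measure G =
     interval_measure (\<lambda>x. (cumulative_variation (right_lim G) x + right_lim G x) / 2)"

definition neg_measure :: "(real \<Rightarrow> real) \<Rightarrow> real measure" where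
  "neg_measure G =
     interval_measure (\<lambda>x. (cumulative_variation (right_lim G) x - right_lim G x) / 2)"

definition real_stieltjes :: "(real \<Rightarrow> real) \<Rightarrow> (real \<Rightarrow> complex) \<Rightarrow> complex" where
  "real_stieltjes G f = (LINT x|pos_measure G. f x) - (LINT x|neg_measure G. f x)"

definition stieltjes :: "(real \<Rightarrow> complex) \<Rightarrow> (real \<Rightarrow> complex) \<Rightarrow> complex" where
  "stieltjes R f =
     real_stieltjes (\<lambda>x. Re (R x)) f + \<i> * real_stieltjes (\<lambda>x. Im (R x)) f"

definition is_antiderivative :: "functional \<Rightarrow> (real \<Rightarrow> complex) \<Rightarrow> bool" where
  "is_antiderivative r R \<longleftrightarrow> locally_bv R \<and> (\<forall>\<phi>. test_function \<phi> \<longrightarrow> r \<phi> = stieltjes R \<phi>)"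

text \<open>By the Riesz representation theorem every distribution of order 0 has an antiderivative.
  Two antiderivatives differ, outside a countable set, by a constant, so that the choice affects
  neither the measure \<open>dR\<close> nor the jumps \<open>R\<^sup>+ - R\<^sup>-\<close>.\<close>

definition antiderivative :: "functional \<Rightarrow> real \<Rightarrow> complex" where
  "antiderivative r = (SOME R. is_antiderivative r R)"

definition jump_mat :: "functional mat \<Rightarrow> real \<Rightarrow> complex mat" (\<open>\<Delta>\<close>) where
  "\<Delta> r x = map_mat (\<lambda>d. right_lim (antiderivative d) x - left_lim (antiderivative d) x) r"

text \<open>The product is meaningful for \<open>f\<close> locally integrable with respect to \<open>|dR|\<close>. Below it
  is only applied to functions of locally bounded variation, which are Borel measurable and
  locally bounded, and hence locally integrable.\<close>

definition dist_mult :: "functional \<Rightarrow> (real \<Rightarrow> complex) \<Rightarrow> functional" where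
  "dist_mult r f \<phi> = stieltjes (antiderivative r) (\<lambda>x. f x * \<phi> x)"

definition dist_mat_vec :: "functional mat \<Rightarrow> (real \<Rightarrow> complex vec) \<Rightarrow> nat \<Rightarrow> functional" where
  "dist_mat_vec r u i \<phi> = (\<Sum>j<dim_col r. dist_mult (r $$ (i, j)) (\<lambda>x. u x $ j) \<phi>)"

definition dist_deriv :: "(real \<Rightarrow> complex) \<Rightarrow> functional" where
  "dist_deriv f \<phi> = - (LINT x|lborel. f x * vector_derivative \<phi> (at x))"

definition solution :: "nat \<Rightarrow> functional mat \<Rightarrow> (real \<Rightarrow> complex vec) \<Rightarrow> bool" where
  "solution n r u \<longleftrightarrow> balanced_vec n u \<and>
     (\<forall>i<n. \<forall>\<phi>. test_function \<phi> \<longrightarrow>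
        dist_deriv (\<lambda>x. u x $ i) \<phi> = dist_mat_vec r u i \<phi>)"

definition fundamental_system ::
  "nat \<Rightarrow> functional mat \<Rightarrow> 'i set \<Rightarrow> ('i \<Rightarrow> real \<Rightarrow> complex vec) \<Rightarrow> bool" where
  "fundamental_system n r I u \<longleftrightarrow>
     finite I \<and>
     (\<forall>i\<in>I. solution n r (u i)) \<and>
     (\<forall>c :: 'i \<Rightarrow> complex.
        (\<forall>x. finsum_vec TYPE(complex) n (\<lambda>i. c i \<cdot>\<^sub>v u i x) I = 0\<^sub>v n) \<longrightarrow> (\<forall>i\<in>I. c i = 0)) \<and>
     (\<forall>v. solution n r v \<longrightarrow>
        (\<exists>c :: 'i \<Rightarrow> complex.
           \<forall>x. v x = finsum_vec TYPE(complex) n (\<lambda>i. c i \<cdot>\<^sub>v u i x) I))"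

definition fundamental_matrix :: "nat \<Rightarrow> functional mat \<Rightarrow> (real \<Rightarrow> complex mat) \<Rightarrow> bool" where
  "fundamental_matrix n r U \<longleftrightarrow>
     (\<forall>x. U x \<in> carrier_mat n n) \<and> fundamental_system n r {..<n} (\<lambda>j x. col (U x) j)"

definition monodromy_matrix :: "nat \<Rightarrow> functional mat \<Rightarrow> real \<Rightarrow> complex mat \<Rightarrow> bool" where
  "monodromy_matrix n r \<omega> M \<longleftrightarrow>
     M \<in> carrier_mat n n \<and> invertible_mat M \<and>
     (\<exists>U. fundamental_matrix n r U \<and> (\<forall>x. U (x + \<omega>) = U x * M))"

fun floquet_q :: "real \<Rightarrow> complex \<Rightarrow> nat \<Rightarrow> real \<Rightarrow> complex" where
  "floquet_q \<omega> \<rho> 0 x = 1"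
| "floquet_q \<omega> \<rho> (Suc j) x =
     floquet_q \<omega> \<rho> j x * (of_real (x - of_nat j * \<omega>) / (of_nat (j + 1) * \<rho> * of_real \<omega>))"

end

theory Submission
  imports Defs
begin

text \<open>
  Let \<open>U (x + \<omega>) = U x M\<close> for a fundamental matrix \<open>U\<close>, and let \<open>M = P J Q\<close> with \<open>Q = P\<^sup>-\<^sup>1\<close> and \<open>J\<close> in Jordan
  form. The matrix \<open>V = U P\<close> is fundamental as well and satisfies \<open>V (x + \<omega>) = V x J\<close>. So the columns
  \<open>v 0, \<dots>, v (\<mu> - 1)\<close> of \<open>V\<close> that belong to a block of size \<open>\<mu>\<close> with eigenvalue \<open>\<rho>\<close> satisfy
  \<open>v l (x + \<omega>) = \<rho> v l x + v (l - 1) x\<close>, where \<open>v (-1) = 0\<close> (\<open>mult_jordan_matrix_index\<close>). The eigenvalue is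
  not zero, for otherwise the solution \<open>v 0\<close> would vanish.

  If \<open>exp (\<alpha> \<omega>) = \<rho>\<close>, the functions \<open>w l x = exp (-\<alpha> x) v l x\<close> satisfy
  \<open>w l (x + \<omega>) = w l x + w (l - 1) x / \<rho>\<close>. The polynomials \<open>q j = floquet_q \<omega> \<rho> j\<close> obey the same law
  (\<open>floquet_q_shift\<close>). Defining \<open>p l\<close> recursively by \<open>w l = (\<Sum>j\<le>l. q j * p (l - j))\<close>, which is
  possible since \<open>q 0 = 1\<close>, one finds by induction on \<open>l\<close> that \<open>p l\<close> is periodic
  (\<open>floquet_p_periodic\<close>). The functions of the theorem are therefore the columns of \<open>V\<close>.

  What remains is analysis. The functions \<open>p l\<close> are balanced because balanced functions form a vector space and
  are preserved under multiplication with continuous functions of locally bounded variation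
  (\<open>balanced_mult_continuous\<close>). That \<open>V\<close> is fundamental rests on constant combinations of solutions being
  solutions (\<open>solution_mult_mat_vec\<close>), that is, on the linearity of the integrals in the equation
  \<open>u' = r u\<close>. They converge absolutely, as the measures involved are finite on bounded intervals
  (\<open>emeasure_interval_measure_Ioc_finite\<close>) and balanced functions are locally bounded and Borel
  measurable, the latter because they are the means of their one-sided limits, which are pointwise limits
  of step functions.
\<close>

section \<open>Functions of locally bounded variation\<close>

lemma variation_sums_memI:
  assumes "mono t" "range t \<subseteq> {a..b}"
  shows "(\<Sum>i<m. norm (f (t (Suc i)) - f (t i))) \<in> variation_sums f a b"
  unfolding variation_sums_def 
  by (rule CollectI, rule exI[of _ m], rule exI[of _ t]) (simp add: assms)

lemma locally_bvE:
  assumes "locally_bv f"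
  obtains C where "\<forall>m t. mono t \<longrightarrow> range t \<subseteq> {a..b} \<longrightarrow>
    (\<Sum>i<m. norm (f (t (Suc i)) - f (t i))) \<le> C"
proof -
  from assms obtain C where "\<forall>v\<in>variation_sums f a b. v \<le> C"
    unfolding locally_bv_def bdd_above_def by presburger
  then have "\<forall>m t. mono t \<longrightarrow> range t \<subseteq> {a..b} \<longrightarrow>
    (\<Sum>i<m. norm (f (t (Suc i)) - f (t i))) \<le> C"
    by (intro allI impI) (rule bspec, assumption, rule variation_sums_memI)
  then show ?thesis by (rule that)
qed

lemma locally_bvI:
  assumes "\<And>a b. \<exists>C. \<forall>m t. mono t \<longrightarrow> range t \<subseteq> {a..b} \<longrightarrow>
    (\<Sum>i<m. norm (f (t (Suc i)) - f (t i))) \<le> C"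
  shows "locally_bv f"
  unfolding locally_bv_def bdd_above_def
proof (intro allI)
  fix a b :: real
  from assms[of a b] obtain C where C: "\<forall>m t. mono t \<longrightarrow> range t \<subseteq> {a..b} \<longrightarrow>
    (\<Sum>i<m. norm (f (t (Suc i)) - f (t i))) \<le> C" by (rule exE)
  show "\<exists>C. \<forall>v\<in>variation_sums f a b. v \<le> C"
  proof (intro exI ballI)
    fix v assume "v \<in> variation_sums f a b"
    then obtain m t where "v = (\<Sum>i<m. norm (f (t (Suc i)) - f (t i)))" "mono t" "range t \<subseteq> {a..b}"
      by (auto simp: variation_sums_def)
    with C show "v \<le> C" by simp
  qed
qed

lemma locally_bv_bounded:
  fixes f :: "real \<Rightarrow> 'a::real_normed_vector"
  assumes "locally_bv f"
  obtains B where "\<forall>x\<in>{a..b}. norm (f x) \<le> B"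
proof -
  obtain C where "\<forall>m t. mono t \<longrightarrow> range t \<subseteq> {a..b} \<longrightarrow>
    (\<Sum>i<m. norm (f (t (Suc i)) - f (t i))) \<le> C"
    by (rule locally_bvE[OF assms, where a="a" and b="b"])
  note C = this[rule_format]
  have "norm (f x) \<le> C + norm (f a)" if x: "x \<in> {a..b}" for x
  proof -
    define t where "t = (\<lambda>i::nat. if i = 0 then a else x)"
    have "mono t" "range t \<subseteq> {a..b}"
      using x by (auto simp: t_def mono_def)
    from C[OF this, of 1] have "norm (f x - f a) \<le> C"
      by (simp add: t_def)
    with norm_triangle_sub[of "f x" "f a"] show ?thesis by simp
  qed
  with that show ?thesis by blast
qed

lemma locally_bv_reflect:
  assumes "locally_bv f"
  shows "locally_bv (\<lambda>x. f (- x))"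
proof (rule locally_bvI)
  fix a b :: real
  obtain C where "\<forall>m t. mono t \<longrightarrow> range t \<subseteq> {-b..-a} \<longrightarrow>
    (\<Sum>i<m. norm (f (t (Suc i)) - f (t i))) \<le> C"
    by (rule locally_bvE[OF assms, where a="-b" and b="-a"])
  note C = this[rule_format]
  have "(\<Sum>i<m. norm (f (- t (Suc i)) - f (- t i))) \<le> C"
    if t: "mono t" "range t \<subseteq> {a..b}" for m and t :: "nat \<Rightarrow> real"
  proof -
    have "mono (\<lambda>i. - t (m - i))" "range (\<lambda>i. - t (m - i)) \<subseteq> {-b..-a}"
      using t by (auto simp: mono_def image_subset_iff)
    from C[OF this, of m]
    have "(\<Sum>i<m. norm (f (- t (m - Suc i)) - f (- t (m - i)))) \<le> C" .
    also have "(\<Sum>i<m. norm (f (- t (m - Suc i)) - f (- t (m - i))))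
      = (\<Sum>i<m. norm (f (- t i) - f (- t (Suc i))))"
      by (subst sum.nat_diff_reindex[symmetric]) (auto intro!: sum.cong simp: Suc_diff_Suc)
    finally show ?thesis by (simp add: norm_minus_commute)
  qed
  then show "\<exists>C. \<forall>m t. mono t \<longrightarrow> range t \<subseteq> {a..b} \<longrightarrow>
    (\<Sum>i<m. norm (f (- t (Suc i)) - f (- t i))) \<le> C" by blast
qed

text \<open>The variation of \<open>f\<close> over \<open>[y, b]\<close> stays bounded as \<open>y\<close> decreases to \<open>x\<close>, which makes the filter of
  values of \<open>f\<close> to the right of \<open>x\<close> a Cauchy filter.\<close>

lemma locally_bv_right_limit_exists:
  fixes f :: "real \<Rightarrow> 'a::banach"
  assumes "locally_bv f"
  shows "\<exists>l. (f \<longlongrightarrow> l) (at_right x)"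
proof -
  define b where "b = x + 1"
  define V where "V y = variation_sums f y b" for y
  obtain C where "\<forall>m t. mono t \<longrightarrow> range t \<subseteq> {x..b} \<longrightarrow>
    (\<Sum>i<m. norm (f (t (Suc i)) - f (t i))) \<le> C"
    by (rule locally_bvE[OF assms, where a="x" and b="b"])
  note C = this[rule_format]
  define W where "W = (\<Union>y\<in>{x<..<b}. V y)"
  have W_bdd: "bdd_above W"
    unfolding bdd_above_def
    using C by (intro exI[of _ C]) (force simp: W_def V_def variation_sums_def)
  have "0 \<in> V ((x + b) / 2)"
    unfolding V_def variation_sums_def
    by (rule CollectI, rule exI[of _ 0], rule exI[of _ "\<lambda>_. b"]) (auto simp: mono_def b_def)
  then have W_ne: "W \<noteq> {}" by (auto simp: W_def b_def intro!: bexI[of _ "(x + b) / 2"])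
  have "cauchy_filter (filtermap f (at_right x))"
    unfolding cauchy_filter_metric_filtermap
  proof (intro allI impI)
    fix e :: real assume e: "e > 0"
    then have "Sup W - e < Sup W" by simp
    with less_cSup_iff[OF W_ne W_bdd] obtain w where w: "w \<in> W" "Sup W - e < w" by blast
    then obtain y0 where y0: "x < y0" "y0 < b" "w \<in> V y0" by (auto simp: W_def)
    then obtain m t where t: "mono t" "range t \<subseteq> {y0..b}"
      and wt: "w = (\<Sum>i<m. norm (f (t (Suc i)) - f (t i)))"
      by (auto simp: V_def variation_sums_def)
    \<comment> \<open>Prefixing a nearly optimal partition of \<open>[y0, b]\<close> by two points shows that \<open>f\<close> hardly
      varies between \<open>x\<close> and \<open>y0\<close>.\<close>
    have close: "norm (f z - f y) < e" if yz: "x < y" "y \<le> z" "z < y0" for y z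
    proof -
      define t' where "t' i = (if i = 0 then y else if i = 1 then z else t (i - 2))" for i :: nat
      have ty: "t i \<ge> y0 \<and> t i \<le> b" for i using t(2) by force
      have "mono t'"
      proof (rule monoI)
        fix i j :: nat assume "i \<le> j"
        then show "t' i \<le> t' j"
          using yz ty[of "j - 2"] monoD[OF t(1), of "i - 2" "j - 2"] by (auto simp: t'_def)
      qed
      moreover have "range t' \<subseteq> {y..b}"
      proof (clarify)
        fix i
        show "t' i \<in> {y..b}" using yz y0 ty[of "i - 2"] by (auto simp: t'_def)
      qed
      ultimately have "(\<Sum>i<m + 2. norm (f (t' (Suc i)) - f (t' i))) \<in> W"
        using yz less_trans[OF yz(3) y0(2)] unfolding W_def V_def
        by (intro UN_I[of y] variation_sums_memI) auto
      then have "(\<Sum>i<m + 2. norm (f (t' (Suc i)) - f (t' i))) \<le> Sup W"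
        by (rule cSup_upper[OF _ W_bdd])
      moreover have "(\<Sum>i<m + 2. norm (f (t' (Suc i)) - f (t' i)))
        = norm (f z - f y) + (norm (f (t 0) - f z) + w)"
        unfolding wt add_2_eq_Suc' sum.lessThan_Suc_shift by (simp add: t'_def)
      moreover have "norm (f (t 0) - f z) \<ge> 0" by simp
      ultimately show ?thesis using w(2) by linarith
    qed
    have "dist (f y) (f z) < e" if "x < y \<and> y < y0" "x < z \<and> z < y0" for y z
      using close[of y z] close[of z y] that
      by (cases "y \<le> z") (auto simp: dist_norm norm_minus_commute)
    moreover have "eventually (\<lambda>y. x < y \<and> y < y0) (at_right x)"
      using y0 eventually_at_right_field by blast
    ultimately show "\<exists>P. eventually P (at_right x) \<and> (\<forall>y z. P y \<and> P z \<longrightarrow> dist (f y) (f z) < e)"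
      by blast
  qed
  then obtain l where "filtermap f (at_right x) \<le> nhds l"
    using complete_UNIV[where 'a='a] unfolding complete_uniform
    by (force simp: filtermap_bot_iff)
  then show ?thesis unfolding filterlim_def by blast
qed

lemma locally_bv_tendsto_right_lim:
  fixes f :: "real \<Rightarrow> 'a::banach"
  assumes "locally_bv f"
  shows "(f \<longlongrightarrow> right_lim f x) (at_right x)"
  using locally_bv_right_limit_exists[OF assms, of x]
  by (auto simp: right_lim_def tendsto_Lim)

lemma locally_bv_tendsto_left_lim:
  fixes f :: "real \<Rightarrow> 'a::banach"
  assumes "locally_bv f"
  shows "(f \<longlongrightarrow> left_lim f x) (at_left x)"
proof -
  obtain l where "((\<lambda>x. f (- x)) \<longlongrightarrow> l) (at_right (- x))"
    using locally_bv_right_limit_exists[OF locally_bv_reflect[OF assms], of "- x"] by blast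
  then have "(f \<longlongrightarrow> l) (at_left x)"
    by (simp add: filterlim_at_left_to_right)
  then show ?thesis by (auto simp: left_lim_def tendsto_Lim)
qed

text \<open>\<open>right_lim\<close> and \<open>left_lim\<close> are defined by \<open>Lim\<close>, which is meaningless without convergence; since
  one-sided limits exist for functions of locally bounded variation, being balanced can be tested on
  any two values that are limits.\<close>

lemma balanced_iff_limits:
  "balanced f \<longleftrightarrow> locally_bv f \<and>
    (\<forall>x. \<exists>p q. (f \<longlongrightarrow> p) (at_right x) \<and> (f \<longlongrightarrow> q) (at_left x) \<and> f x = (p + q) / 2)"
proof (intro iffI conjI allI)
  assume f: "balanced f"
  then show "locally_bv f" by (simp add: balanced_def)
  with f show "\<exists>p q. (f \<longlongrightarrow> p) (at_right x) \<and> (f \<longlongrightarrow> q) (at_left x) \<and> f x = (p + q) / 2" for x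
    using locally_bv_tendsto_right_lim[of f x] locally_bv_tendsto_left_lim[of f x]
    by (auto simp: balanced_def)
next
  assume f: "locally_bv f \<and>
    (\<forall>x. \<exists>p q. (f \<longlongrightarrow> p) (at_right x) \<and> (f \<longlongrightarrow> q) (at_left x) \<and> f x = (p + q) / 2)"
  have "f x = (right_lim f x + left_lim f x) / 2" for x
  proof -
    obtain p q where "(f \<longlongrightarrow> p) (at_right x)" "(f \<longlongrightarrow> q) (at_left x)" "f x = (p + q) / 2"
      using f by blast
    then show ?thesis by (simp add: right_lim_def left_lim_def tendsto_Lim)
  qed
  with f show "balanced f" by (simp add: balanced_def)
qed

lemma locally_bv_add:
  assumes "locally_bv f" "locally_bv g"
  shows "locally_bv (\<lambda>x. f x + g x)"
proof (rule locally_bvI)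
  fix a b :: real
  obtain C where "\<forall>m t. mono t \<longrightarrow> range t \<subseteq> {a..b} \<longrightarrow>
    (\<Sum>i<m. norm (f (t (Suc i)) - f (t i))) \<le> C"
    by (rule locally_bvE[OF assms(1), where a="a" and b="b"])
  note C = this[rule_format]
  obtain D where "\<forall>m t. mono t \<longrightarrow> range t \<subseteq> {a..b} \<longrightarrow>
    (\<Sum>i<m. norm (g (t (Suc i)) - g (t i))) \<le> D"
    by (rule locally_bvE[OF assms(2), where a="a" and b="b"])
  note D = this[rule_format]
  have "(\<Sum>i<m. norm (f (t (Suc i)) + g (t (Suc i)) - (f (t i) + g (t i)))) \<le> C + D"
    if "mono t" "range t \<subseteq> {a..b}" for m and t :: "nat \<Rightarrow> real"
  proof -
    have "(\<Sum>i<m. norm (f (t (Suc i)) + g (t (Suc i)) - (f (t i) + g (t i))))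
      \<le> (\<Sum>i<m. norm (f (t (Suc i)) - f (t i)) + norm (g (t (Suc i)) - g (t i)))"
      by (intro sum_mono norm_diff_triangle_ineq)
    with C[OF that, of m] D[OF that, of m] show ?thesis by (simp add: sum.distrib)
  qed
  then show "\<exists>C. \<forall>m t. mono t \<longrightarrow> range t \<subseteq> {a..b} \<longrightarrow>
    (\<Sum>i<m. norm (f (t (Suc i)) + g (t (Suc i)) - (f (t i) + g (t i)))) \<le> C" by blast
qed

lemma locally_bv_mult:
  fixes f g :: "real \<Rightarrow> 'a::real_normed_algebra"
  assumes "locally_bv f" "locally_bv g"
  shows "locally_bv (\<lambda>x. f x * g x)"
proof (rule locally_bvI)
  fix a b :: real
  obtain C where "\<forall>m t. mono t \<longrightarrow> range t \<subseteq> {a..b} \<longrightarrow>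
    (\<Sum>i<m. norm (f (t (Suc i)) - f (t i))) \<le> C"
    by (rule locally_bvE[OF assms(1), where a="a" and b="b"])
  note C = this[rule_format]
  obtain D where "\<forall>m t. mono t \<longrightarrow> range t \<subseteq> {a..b} \<longrightarrow>
    (\<Sum>i<m. norm (g (t (Suc i)) - g (t i))) \<le> D"
    by (rule locally_bvE[OF assms(2), where a="a" and b="b"])
  note D = this[rule_format]
  obtain B where B: "\<forall>x\<in>{a..b}. norm (f x) \<le> B"
    by (rule locally_bv_bounded[OF assms(1), where a="a" and b="b"])
  note B = B[rule_format]
  obtain E where E: "\<forall>x\<in>{a..b}. norm (g x) \<le> E"
    by (rule locally_bv_bounded[OF assms(2), where a="a" and b="b"])
  note E = E[rule_format]
  have "(\<Sum>i<m. norm (f (t (Suc i)) * g (t (Suc i)) - f (t i) * g (t i))) \<le> B * D + C * E"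
    if t: "mono t" "range t \<subseteq> {a..b}" for m and t :: "nat \<Rightarrow> real"
  proof -
    have tin: "t i \<in> {a..b}" for i using t(2) by blast
    have BE: "0 \<le> B" "0 \<le> E" using B[OF tin] E[OF tin] norm_ge_zero order_trans by blast+
    have step: "norm (f y * g y - f x * g x) \<le> B * norm (g y - g x) + norm (f y - f x) * E"
      if "x \<in> {a..b}" "y \<in> {a..b}" for x y
    proof -
      have "f y * g y - f x * g x = f y * (g y - g x) + (f y - f x) * g x"
        by (simp add: algebra_simps)
      also have "norm \<dots> \<le> norm (f y) * norm (g y - g x) + norm (f y - f x) * norm (g x)"
        by (intro order_trans[OF norm_triangle_ineq] add_mono norm_mult_ineq)
      also have "\<dots> \<le> B * norm (g y - g x) + norm (f y - f x) * E"
        using that B E by (intro add_mono mult_mono BE) auto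
      finally show ?thesis .
    qed
    have "(\<Sum>i<m. norm (f (t (Suc i)) * g (t (Suc i)) - f (t i) * g (t i)))
      \<le> (\<Sum>i<m. B * norm (g (t (Suc i)) - g (t i)) + norm (f (t (Suc i)) - f (t i)) * E)"
      by (intro sum_mono step tin)
    also have "\<dots> = B * (\<Sum>i<m. norm (g (t (Suc i)) - g (t i)))
        + (\<Sum>i<m. norm (f (t (Suc i)) - f (t i))) * E"
      by (simp add: sum.distrib sum_distrib_left sum_distrib_right)
    also have "\<dots> \<le> B * D + C * E"
      using C[OF t] D[OF t] BE by (intro add_mono mult_left_mono mult_right_mono)
    finally show ?thesis .
  qed
  then show "\<exists>C. \<forall>m t. mono t \<longrightarrow> range t \<subseteq> {a..b} \<longrightarrow>
    (\<Sum>i<m. norm (f (t (Suc i)) * g (t (Suc i)) - f (t i) * g (t i))) \<le> C" by blast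
qed

lemma locally_bv_C1:
  fixes f :: "real \<Rightarrow> 'a::real_normed_vector"
  assumes deriv: "\<And>x. (f has_vector_derivative f' x) (at x)"
    and cont: "continuous_on UNIV f'"
  shows "locally_bv f"
proof (rule locally_bvI)
  fix a b :: real
  have "bounded (f' ` {a..b})"
    using cont by (intro compact_imp_bounded compact_continuous_image)
      (auto intro: continuous_on_subset)
  then obtain L where L: "\<And>x. x \<in> {a..b} \<Longrightarrow> norm (f' x) \<le> L"
    unfolding bounded_iff by blast
  have "(\<Sum>i<m. norm (f (t (Suc i)) - f (t i))) \<le> \<bar>L\<bar> * (b - a)"
    if t: "mono t" "range t \<subseteq> {a..b}" for m and t :: "nat \<Rightarrow> real"
  proof -
    have tin: "t i \<in> {a..b}" for i using t(2) by blast
    have lip: "norm (f y - f x) \<le> L * norm (y - x)" if "x \<in> {a..b}" "y \<in> {a..b}" for x y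
    proof (rule differentiable_bound[of "{a..b}" f "\<lambda>x h. h *\<^sub>R f' x"])
      show "(f has_derivative (\<lambda>h. h *\<^sub>R f' z)) (at z within {a..b})" for z
        using deriv[of z] unfolding has_vector_derivative_def
        by (rule has_derivative_at_withinI)
      show "onorm (\<lambda>h. h *\<^sub>R f' z) \<le> L" if "z \<in> {a..b}" for z
        using L[OF that] by (intro onorm_le) (metis mult.commute mult_right_mono norm_ge_zero norm_scaleR real_norm_def)
    qed (use that in auto)
    have "(\<Sum>i<m. norm (f (t (Suc i)) - f (t i))) \<le> (\<Sum>i<m. L * norm (t (Suc i) - t i))"
      by (intro sum_mono lip tin)
    also have "\<dots> = (\<Sum>i<m. L * (t (Suc i) - t i))"
      using monoD[OF t(1), of _ "Suc _"] by (intro sum.cong) simp_all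
    also have "\<dots> = L * (t m - t 0)"
      by (simp add: sum_distrib_left[symmetric] sum_lessThan_telescope)
    also have "\<dots> \<le> \<bar>L\<bar> * (b - a)"
      using tin[of m] tin[of 0] monoD[OF t(1), of 0 m] by (intro mult_mono) auto
    finally show ?thesis .
  qed
  then show "\<exists>C. \<forall>m t. mono t \<longrightarrow> range t \<subseteq> {a..b} \<longrightarrow>
    (\<Sum>i<m. norm (f (t (Suc i)) - f (t i))) \<le> C" by blast
qed

lemma locally_bv_const: "locally_bv (\<lambda>x. c)"
  by (rule locally_bv_C1[of _ "\<lambda>_. 0"]) (auto intro!: derivative_eq_intros)

lemma balanced_add:
  assumes "balanced f" "balanced g"
  shows "balanced (\<lambda>x. f x + g x)"
  unfolding balanced_iff_limits
proof (intro conjI allI)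
  show "locally_bv (\<lambda>x. f x + g x)"
    using assms by (intro locally_bv_add) (auto simp: balanced_def)
  fix x
  obtain p q where pq: "(f \<longlongrightarrow> p) (at_right x)" "(f \<longlongrightarrow> q) (at_left x)" "f x = (p + q) / 2"
    using assms(1) unfolding balanced_iff_limits by blast
  obtain p' q' where pq': "(g \<longlongrightarrow> p') (at_right x)" "(g \<longlongrightarrow> q') (at_left x)" "g x = (p' + q') / 2"
    using assms(2) unfolding balanced_iff_limits by blast
  show "\<exists>p q. ((\<lambda>x. f x + g x) \<longlongrightarrow> p) (at_right x) \<and> ((\<lambda>x. f x + g x) \<longlongrightarrow> q) (at_left x)
      \<and> f x + g x = (p + q) / 2"
    by (rule exI[of _ "p + p'"], rule exI[of _ "q + q'"])
      (use pq pq' in \<open>simp add: tendsto_add add_divide_distrib\<close>)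
qed

lemma balanced_mult_continuous:
  assumes "locally_bv g" "continuous_on UNIV g" "balanced f"
  shows "balanced (\<lambda>x. g x * f x)"
  unfolding balanced_iff_limits
proof (intro conjI allI)
  show "locally_bv (\<lambda>x. g x * f x)"
    using assms by (intro locally_bv_mult) (auto simp: balanced_def)
  fix x
  obtain p q where pq: "(f \<longlongrightarrow> p) (at_right x)" "(f \<longlongrightarrow> q) (at_left x)" "f x = (p + q) / 2"
    using assms(3) unfolding balanced_iff_limits by blast
  have "(g \<longlongrightarrow> g x) (at x)"
    using assms(2) by (simp add: continuous_on_def)
  then have g: "(g \<longlongrightarrow> g x) (at_right x)" "(g \<longlongrightarrow> g x) (at_left x)"
    by (auto intro: tendsto_mono[OF at_le])
  show "\<exists>p q. ((\<lambda>x. g x * f x) \<longlongrightarrow> p) (at_right x) \<and> ((\<lambda>x. g x * f x) \<longlongrightarrow> q) (at_left x)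
      \<and> g x * f x = (p + q) / 2"
    by (rule exI[of _ "g x * p"], rule exI[of _ "g x * q"])
      (simp add: pq g tendsto_mult distrib_left[symmetric])
qed

lemma balanced_cmult: "balanced f \<Longrightarrow> balanced (\<lambda>x. c * f x)"
  by (rule balanced_mult_continuous) (auto intro: locally_bv_const)

lemma balanced_zero: "balanced (\<lambda>x. 0)"
  unfolding balanced_iff_limits by (auto intro!: locally_bv_const exI[of _ 0])

lemma balanced_sum: "(\<And>i. i \<in> I \<Longrightarrow> balanced (f i)) \<Longrightarrow> balanced (\<lambda>x. \<Sum>i\<in>I. f i x)"
  by (induction I rule: infinite_finite_induct) (auto intro: balanced_zero balanced_add)

lemma balanced_diff:
  assumes "balanced f" "balanced g"
  shows "balanced (\<lambda>x. f x - g x)"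
  using balanced_add[OF assms(1) balanced_cmult[OF assms(2), of "-1"]] by simp

section \<open>Integrals of balanced functions against test functions\<close>

text \<open>No assumption on \<open>F\<close> is needed: \<open>interval_measure F\<close> either gives \<open>{a<..b}\<close> the measure
  \<open>ennreal (F b - F a)\<close>, or, if no measure does this for all intervals, it is the null measure.
  Hence the integrals that define \<open>stieltjes R\<close> converge on balanced functions of compact support
  whatever \<open>R\<close> is.\<close>

lemma emeasure_interval_measure_Ioc_finite: "emeasure (interval_measure F) {a<..b} < \<infinity>"
proof (cases "a \<le> b")
  case True
  let ?G = "\<lambda>(a, b). {a<..b::real}"
  let ?I = "{(a, b). a \<le> (b::real)}"
  let ?\<mu> = "\<lambda>(a, b). ennreal (F b - F a)"
  let ?P = "\<lambda>\<mu>'. (\<forall>i\<in>?I. \<mu>' (?G i) = ?\<mu> i) \<and> measure_space UNIV (sigma_sets UNIV (?G ` ?I)) \<mu>'"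
  show ?thesis
  proof (cases "(\<exists>\<mu>'. ?P \<mu>') \<and> \<not> (\<forall>i\<in>?I. ?\<mu> i = 0)")
    case ex: True
    then have "?P (SOME \<mu>'. ?P \<mu>')" by (intro someI_ex[of ?P]) simp
    then have "\<forall>i\<in>?I. (SOME \<mu>'. ?P \<mu>') (?G i) = ?\<mu> i" by (rule conjunct1)
    from bspec[OF this, of "(a, b)"] True
    have "(SOME \<mu>'. ?P \<mu>') {a<..b} = ennreal (F b - F a)" by simp
    then show ?thesis
      unfolding interval_measure_def extend_measure_def if_P[OF ex]
      by (simp add: emeasure_measure_of_conv)
  next
    case False
    show ?thesis
      unfolding interval_measure_def extend_measure_def if_not_P[OF False]
      by (simp add: emeasure_measure_of_conv)
  qed
qed simp

lemma step_function_borel: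
  fixes f :: "real \<Rightarrow> complex" and k :: "real \<Rightarrow> int"
  assumes "k \<in> measurable borel (count_space UNIV)"
  shows "(\<lambda>x. f (of_int (k x) / c)) \<in> borel_measurable borel"
  using measurable_compose[OF assms, of "\<lambda>i. f (of_int i / c)" borel] by simp

lemma tendsto_const_div_Suc: "(\<lambda>n. c / real (Suc n)) \<longlonglongrightarrow> 0"
  using LIMSEQ_Suc[OF lim_const_over_n[of c]] by simp

text \<open>The left limit at \<open>x\<close> is the limit of the values of \<open>f\<close> at the largest point of the grid
  \<open>(1 / (n + 1)) \<int>\<close> strictly below \<open>x\<close>. As a function of \<open>x\<close> each of these values is a step function.
  Likewise on the right.\<close>

lemma left_lim_borel:
  fixes f :: "real \<Rightarrow> complex"
  assumes "locally_bv f"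
  shows "left_lim f \<in> borel_measurable borel"
proof (rule borel_measurable_LIMSEQ_metric)
  fix n :: nat
  show "(\<lambda>x. f (of_int (\<lceil>real (Suc n) * x\<rceil> - 1) / real (Suc n))) \<in> borel_measurable borel"
    by (rule step_function_borel) measurable
next
  fix x :: real
  let ?g = "\<lambda>n. of_int (\<lceil>real (Suc n) * x\<rceil> - 1) / real (Suc n)"
  have lt: "?g n < x" and ge: "x - 1 / real (Suc n) \<le> ?g n" for n
  proof -
    have "of_int (\<lceil>real (Suc n) * x\<rceil> - 1) < real (Suc n) * x"
      "real (Suc n) * x - 1 \<le> of_int (\<lceil>real (Suc n) * x\<rceil> - 1)"
      by linarith+
    moreover have "x - 1 / real (Suc n) = (real (Suc n) * x - 1) / real (Suc n)"
      by (simp add: diff_divide_distrib del: of_nat_Suc)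
    ultimately show "?g n < x" "x - 1 / real (Suc n) \<le> ?g n"
      by (simp_all add: pos_divide_less_eq divide_right_mono mult.commute[of x]
          del: of_nat_Suc of_int_diff)
  qed
  have "?g \<longlonglongrightarrow> x"
  proof (rule tendsto_sandwich[of "\<lambda>n. x - 1 / real (Suc n)" _ _ "\<lambda>_. x"])
    show "(\<lambda>n. x - 1 / real (Suc n)) \<longlonglongrightarrow> x"
      using tendsto_diff[OF tendsto_const[of x] tendsto_const_div_Suc[of 1]] by simp
  qed (use lt ge in \<open>auto intro!: always_eventually less_imp_le simp del: of_nat_Suc of_int_diff\<close>)
  with lt have "filterlim ?g (at_left x) sequentially"
    by (simp add: filterlim_at del: of_nat_Suc of_int_diff) (simp add: less_imp_neq)
  from filterlim_compose[OF locally_bv_tendsto_left_lim[OF assms] this]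
  show "(\<lambda>n. f (?g n)) \<longlonglongrightarrow> left_lim f x" .
qed

lemma right_lim_borel:
  fixes f :: "real \<Rightarrow> complex"
  assumes "locally_bv f"
  shows "right_lim f \<in> borel_measurable borel"
proof (rule borel_measurable_LIMSEQ_metric)
  fix n :: nat
  show "(\<lambda>x. f (of_int (\<lfloor>real (Suc n) * x\<rfloor> + 1) / real (Suc n))) \<in> borel_measurable borel"
    by (rule step_function_borel) measurable
next
  fix x :: real
  let ?g = "\<lambda>n. of_int (\<lfloor>real (Suc n) * x\<rfloor> + 1) / real (Suc n)"
  have gt: "x < ?g n" and le: "?g n \<le> x + 1 / real (Suc n)" for n
  proof -
    have "real (Suc n) * x < of_int (\<lfloor>real (Suc n) * x\<rfloor> + 1)"
      "of_int (\<lfloor>real (Suc n) * x\<rfloor> + 1) \<le> real (Suc n) * x + 1"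
      by linarith+
    moreover have "x + 1 / real (Suc n) = (real (Suc n) * x + 1) / real (Suc n)"
      by (simp add: add_divide_distrib del: of_nat_Suc)
    ultimately show "x < ?g n" "?g n \<le> x + 1 / real (Suc n)"
      by (simp_all add: pos_less_divide_eq divide_right_mono mult.commute[of x]
          del: of_nat_Suc of_int_add)
  qed
  have "?g \<longlonglongrightarrow> x"
  proof (rule tendsto_sandwich[of "\<lambda>_. x" _ _ "\<lambda>n. x + 1 / real (Suc n)"])
    show "(\<lambda>n. x + 1 / real (Suc n)) \<longlonglongrightarrow> x"
      using tendsto_add[OF tendsto_const[of x] tendsto_const_div_Suc[of 1]] by simp
  qed (use gt le in \<open>auto intro!: always_eventually less_imp_le simp del: of_nat_Suc of_int_add\<close>)
  moreover have "\<forall>n. ?g n \<in> {x<..} \<and> ?g n \<noteq> x"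
    using gt by (metis greaterThan_iff less_irrefl)
  ultimately have "filterlim ?g (at_right x) sequentially"
    unfolding filterlim_at by (blast intro: always_eventually)
  from filterlim_compose[OF locally_bv_tendsto_right_lim[OF assms] this]
  show "(\<lambda>n. f (?g n)) \<longlonglongrightarrow> right_lim f x" .
qed

lemma balanced_borel:
  assumes "balanced f"
  shows "f \<in> borel_measurable borel"
proof -
  have bv: "locally_bv f" and eq: "f = (\<lambda>x. (right_lim f x + left_lim f x) / 2)"
    using assms by (auto simp: balanced_def)
  show ?thesis
    by (subst eq) (intro borel_measurable_divide borel_measurable_add borel_measurable_const
        right_lim_borel[OF bv] left_lim_borel[OF bv])
qed

lemma integrable_balanced_mult:
  assumes M: "sets M = sets borel" "emeasure M {a<..b} < \<infinity>"
    and f: "balanced f" and g: "continuous_on UNIV g" "\<And>x. x \<notin> {a<..b} \<Longrightarrow> g x = 0"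
  shows "integrable M (\<lambda>x. f x * g x :: complex)"
proof -
  obtain B where B: "\<forall>x\<in>{a..b}. norm (f x) \<le> B"
    by (rule locally_bv_bounded[where a=a and b=b]) (use f in \<open>auto simp: balanced_def\<close>)
  have "bounded (g ` {a..b})"
    using g(1) by (intro compact_imp_bounded compact_continuous_image)
      (auto intro: continuous_on_subset)
  then obtain D where D: "\<forall>x\<in>{a..b}. norm (g x) \<le> D"
    unfolding bounded_iff by blast
  have [measurable]: "f \<in> borel_measurable borel" "g \<in> borel_measurable borel"
    using balanced_borel[OF f] borel_measurable_continuous_onI[OF g(1)] by auto
  show ?thesis
  proof (rule integrableI_bounded_set[where A="{a<..b}" and B="B * D"])
    show "(\<lambda>x. f x * g x) \<in> borel_measurable M"
      unfolding measurable_cong_sets[OF M(1) refl] by measurable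
    show "AE x in M. x \<in> {a<..b} \<longrightarrow> norm (f x * g x) \<le> B * D"
    proof (intro AE_I2 impI)
      fix x assume "x \<in> {a<..b}"
      then have "norm (f x) \<le> B" "norm (g x) \<le> D" using B D by auto
      moreover from \<open>norm (f x) \<le> B\<close> have "0 \<le> B"
        using norm_ge_zero[of "f x"] by linarith
      ultimately show "norm (f x * g x) \<le> B * D"
        unfolding norm_mult by (intro mult_mono) simp_all
    qed
  qed (use M g(2) in auto)
qed

lemma test_function_support:
  assumes "test_function \<phi>"
  obtains a b where "\<forall>x. x \<notin> {a<..b} \<longrightarrow> \<phi> x = 0 \<and> vector_derivative \<phi> (at x) = 0"
proof -
  have "bounded (supp \<phi>)"
    using assms by (auto simp: test_function_def intro: compact_imp_bounded)
  then obtain N where N: "\<forall>x\<in>supp \<phi>. norm x \<le> N" unfolding bounded_iff by blast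
  have out: "\<phi> x = 0 \<and> vector_derivative \<phi> (at x) = 0" if x: "x \<notin> {- N - 1<..N}" for x
  proof -
    have "x \<notin> supp \<phi>" if "\<bar>x\<bar> > N" for x
      using N that by auto
    then have zero: "\<phi> x = 0" if "\<bar>x\<bar> > N" for x
      using that closure_subset[of "{x. \<phi> x \<noteq> 0}"] by (auto simp: supp_def)
    have "x < - N \<or> x > N" using x by auto
    then have "\<bar>x\<bar> > N" by linarith
    have "open {y. N < \<bar>y\<bar>}" by (intro open_Collect_less continuous_intros)
    then have "eventually (\<lambda>y. y \<in> {y. N < \<bar>y\<bar>}) (nhds x)"
      by (rule eventually_nhds_in_open) (simp add: \<open>\<bar>x\<bar> > N\<close>)
    then have "eventually (\<lambda>y. \<phi> y = 0) (nhds x)"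
      by (rule eventually_mono) (simp add: zero)
    then have "vector_derivative \<phi> (at x) = vector_derivative (\<lambda>_. 0) (at x)"
      by (intro vector_derivative_cong_eq refl)
        (simp_all add: eventually_at_filter eventually_mono)
    with zero[OF \<open>\<bar>x\<bar> > N\<close>] show ?thesis by simp
  qed
  then show ?thesis using that by blast
qed

lemma test_function_continuous:
  assumes "test_function \<phi>"
  shows "continuous_on UNIV \<phi>" "continuous_on UNIV (\<lambda>x. vector_derivative \<phi> (at x))"
proof -
  have sm: "((\<lambda>g y. vector_derivative g (at y)) ^^ k) \<phi> differentiable (at x)" for k x
    using assms by (simp add: test_function_def smooth_def)
  show "continuous_on UNIV \<phi>"
    using sm[of 0] by (auto intro!: continuous_at_imp_continuous_on differentiable_imp_continuous_within)
  show "continuous_on UNIV (\<lambda>x. vector_derivative \<phi> (at x))"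
    using sm[of 1] by (auto intro!: continuous_at_imp_continuous_on differentiable_imp_continuous_within)
qed

lemma real_stieltjes_sum:
  assumes \<phi>: "test_function \<phi>" and f: "\<And>i. i \<in> I \<Longrightarrow> balanced (f i)"
  shows "real_stieltjes G (\<lambda>x. (\<Sum>i\<in>I. f i x * c i) * \<phi> x)
    = (\<Sum>i\<in>I. real_stieltjes G (\<lambda>x. f i x * \<phi> x) * c i)"
proof -
  obtain a b where ab: "\<forall>x. x \<notin> {a<..b} \<longrightarrow> \<phi> x = 0 \<and> vector_derivative \<phi> (at x) = 0"
    by (rule test_function_support[OF \<phi>])
  have lin: "(LINT x|interval_measure F. (\<Sum>i\<in>I. f i x * c i) * \<phi> x)
    = (\<Sum>i\<in>I. (LINT x|interval_measure F. f i x * \<phi> x) * c i)" for F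
  proof -
    have int: "integrable (interval_measure F) (\<lambda>x. f i x * \<phi> x)" if "i \<in> I" for i
      by (rule integrable_balanced_mult[where a=a and b=b,
            OF _ emeasure_interval_measure_Ioc_finite f[OF that]
            test_function_continuous(1)[OF \<phi>]])
        (use ab in auto)
    have "(\<lambda>x. (\<Sum>i\<in>I. f i x * c i) * \<phi> x) = (\<lambda>x. \<Sum>i\<in>I. f i x * \<phi> x * c i)"
      by (simp add: sum_distrib_left sum_distrib_right mult_ac)
    then show ?thesis using int by (simp add: Bochner_Integration.integral_sum)
  qed
  show ?thesis
    unfolding real_stieltjes_def pos_measure_def neg_measure_def lin
    by (simp only: left_diff_distrib sum_subtractf)
qed

text \<open>Both sides of the differential equation \<open>u' = r u\<close> are linear in \<open>u\<close>. As the integrals involved are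
  Bochner integrals, this needs integrability.\<close>

lemma dist_mult_sum:
  assumes "test_function \<phi>" "\<And>i. i \<in> I \<Longrightarrow> balanced (f i)"
  shows "dist_mult d (\<lambda>x. \<Sum>i\<in>I. f i x * c i) \<phi> = (\<Sum>i\<in>I. dist_mult d (f i) \<phi> * c i)"
proof -
  have "real_stieltjes G (\<lambda>x. (\<Sum>i\<in>I. f i x * c i) * \<phi> x)
    = (\<Sum>i\<in>I. real_stieltjes G (\<lambda>x. f i x * \<phi> x) * c i)" for G
    by (rule real_stieltjes_sum[OF assms])
  then show ?thesis
    unfolding dist_mult_def stieltjes_def
    by (simp only: distrib_right sum.distrib sum_distrib_left mult.assoc)
qed

lemma dist_deriv_sum:
  assumes \<phi>: "test_function \<phi>" and f: "\<And>i. i \<in> I \<Longrightarrow> balanced (f i)"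
  shows "dist_deriv (\<lambda>x. \<Sum>i\<in>I. f i x * c i) \<phi> = (\<Sum>i\<in>I. dist_deriv (f i) \<phi> * c i)"
proof -
  obtain a b where ab: "\<forall>x. x \<notin> {a<..b} \<longrightarrow> \<phi> x = 0 \<and> vector_derivative \<phi> (at x) = 0"
    by (rule test_function_support[OF \<phi>])
  let ?d = "\<lambda>x. vector_derivative \<phi> (at x)"
  have int: "integrable lborel (\<lambda>x. f i x * ?d x)" if "i \<in> I" for i
  proof (rule integrable_balanced_mult[where a=a and b=b,
        OF _ _ f[OF that] test_function_continuous(2)[OF \<phi>]])
    show "emeasure lborel {a<..b} < \<infinity>" by (cases "a \<le> b") auto
  qed (use ab in auto)
  have "(\<lambda>x. (\<Sum>i\<in>I. f i x * c i) * ?d x) = (\<lambda>x. \<Sum>i\<in>I. f i x * ?d x * c i)"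
    by (simp add: sum_distrib_left sum_distrib_right mult_ac)
  then show ?thesis
    unfolding dist_deriv_def using int
    by (simp add: Bochner_Integration.integral_sum sum_negf)
qed

lemma balanced_mult_const: "balanced f \<Longrightarrow> balanced (\<lambda>x. f x * c)"
  using balanced_cmult[of f c] by (simp only: mult.commute)

section \<open>Solutions and fundamental matrices\<close>

lemma solution_mult_mat_vec:
  assumes U: "\<And>x. U x \<in> carrier_mat n n" and sol: "\<And>j. j < n \<Longrightarrow> solution n r (\<lambda>x. col (U x) j)"
    and c: "c \<in> carrier_vec n"
    and r: "r \<in> carrier_mat n n"
  shows "solution n r (\<lambda>x. U x *\<^sub>v c)"
proof -
  have U_dim: "dim_row (U x) = n" "dim_col (U x) = n" for x using U[of x] by auto
  have bal: "balanced (\<lambda>x. U x $$ (i, j))" if "i < n" "j < n" for i j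
    using sol[OF that(2)] that U_dim by (simp add: solution_def balanced_vec_def)
  have ent: "(U x *\<^sub>v c) $ i = (\<Sum>j<n. U x $$ (i, j) * c $ j)" if "i < n" for i x
    using that c U_dim by (simp add: scalar_prod_def atLeast0LessThan)
  show ?thesis
    unfolding solution_def balanced_vec_def
  proof (intro conjI allI impI)
    show "U x *\<^sub>v c \<in> carrier_vec n" for x
      by (rule mult_mat_vec_carrier[OF U c])
    fix i assume i: "i < n"
    show "balanced (\<lambda>x. (U x *\<^sub>v c) $ i)"
      unfolding ent[OF i] by (intro balanced_sum balanced_mult_const bal i) simp
    fix \<phi> assume \<phi>: "test_function \<phi>"
    have eq: "dist_deriv (\<lambda>x. U x $$ (i, j)) \<phi>
        = (\<Sum>k<n. dist_mult (r $$ (i, k)) (\<lambda>x. U x $$ (k, j)) \<phi>)" if "j < n" for j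
    proof -
      have "dist_deriv (\<lambda>x. col (U x) j $ i) \<phi>
          = (\<Sum>k<n. dist_mult (r $$ (i, k)) (\<lambda>x. col (U x) j $ k) \<phi>)"
        using sol[OF that] i \<phi> r by (simp add: solution_def dist_mat_vec_def)
      moreover have "col (U x) j $ k = U x $$ (k, j)" if "k < n" for x k
        using \<open>j < n\<close> that U_dim by simp
      ultimately show ?thesis using i by simp
    qed
    have "dist_deriv (\<lambda>x. (U x *\<^sub>v c) $ i) \<phi> = (\<Sum>j<n. dist_deriv (\<lambda>x. U x $$ (i, j)) \<phi> * c $ j)"
      unfolding ent[OF i] by (intro dist_deriv_sum \<phi> bal i) simp
    also have "\<dots> = (\<Sum>j<n. \<Sum>k<n. dist_mult (r $$ (i, k)) (\<lambda>x. U x $$ (k, j)) \<phi> * c $ j)"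
      by (simp add: eq sum_distrib_right)
    also have "\<dots> = (\<Sum>k<n. \<Sum>j<n. dist_mult (r $$ (i, k)) (\<lambda>x. U x $$ (k, j)) \<phi> * c $ j)"
      by (rule sum.swap)
    also have "\<dots> = (\<Sum>k<n. dist_mult (r $$ (i, k)) (\<lambda>x. (U x *\<^sub>v c) $ k) \<phi>)"
    proof (intro sum.cong refl)
      fix k assume "k \<in> {..<n}"
      then have k: "k < n" by simp
      show "(\<Sum>j<n. dist_mult (r $$ (i, k)) (\<lambda>x. U x $$ (k, j)) \<phi> * c $ j)
          = dist_mult (r $$ (i, k)) (\<lambda>x. (U x *\<^sub>v c) $ k) \<phi>"
        unfolding ent[OF k] by (intro dist_mult_sum[symmetric] \<phi> bal k) simp
    qed
    also have "\<dots> = dist_mat_vec r (\<lambda>x. U x *\<^sub>v c) i \<phi>"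
      using r by (simp add: dist_mat_vec_def)
    finally show "dist_deriv (\<lambda>x. (U x *\<^sub>v c) $ i) \<phi> = dist_mat_vec r (\<lambda>x. U x *\<^sub>v c) i \<phi>" .
  qed
qed

lemma finsum_vec_in_carrier:
  "(\<And>i. i \<in> I \<Longrightarrow> f i \<in> carrier_vec n) \<Longrightarrow> finsum_vec TYPE(complex) n f I \<in> carrier_vec n"
  by (rule finsum_vec_closed) auto

lemma index_finsum_vec_lincomb:
  assumes "finite I" "\<And>i. i \<in> I \<Longrightarrow> u i \<in> carrier_vec n" "m < n"
  shows "finsum_vec TYPE(complex) n (\<lambda>i. c i \<cdot>\<^sub>v u i) I $ m = (\<Sum>i\<in>I. c i * u i $ m)"
proof -
  have "finsum_vec TYPE(complex) n (\<lambda>i. c i \<cdot>\<^sub>v u i) I $ m = (\<Sum>i\<in>I. (c i \<cdot>\<^sub>v u i) $ m)"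
    using assms by (intro index_finsum_vec) auto
  also have "\<dots> = (\<Sum>i\<in>I. c i * u i $ m)"
  proof (rule sum.cong)
    fix i assume "i \<in> I"
    from assms(2)[OF this] assms(3) show "(c i \<cdot>\<^sub>v u i) $ m = c i * u i $ m" by simp
  qed simp
  finally show ?thesis .
qed

lemma finsum_vec_cols:
  assumes A: "A \<in> carrier_mat n n"
  shows "finsum_vec TYPE(complex) n (\<lambda>j. c j \<cdot>\<^sub>v col A j) {..<n} = A *\<^sub>v vec n c"
proof (rule eq_vecI)
  have car: "finsum_vec TYPE(complex) n (\<lambda>j. c j \<cdot>\<^sub>v col A j) {..<n} \<in> carrier_vec n"
    using A by (intro finsum_vec_in_carrier) auto
  show "dim_vec (finsum_vec TYPE(complex) n (\<lambda>j. c j \<cdot>\<^sub>v col A j) {..<n}) = dim_vec (A *\<^sub>v vec n c)"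
    using carrier_vecD[OF car] A by simp
  fix i assume "i < dim_vec (A *\<^sub>v vec n c)"
  then have i: "i < n" using A by simp
  have "finsum_vec TYPE(complex) n (\<lambda>j. c j \<cdot>\<^sub>v col A j) {..<n} $ i = (\<Sum>j<n. c j * col A j $ i)"
    using A i by (intro index_finsum_vec_lincomb) auto
  also have "\<dots> = (A *\<^sub>v vec n c) $ i"
    using A i by (simp add: scalar_prod_def atLeast0LessThan mult.commute)
  finally show "finsum_vec TYPE(complex) n (\<lambda>j. c j \<cdot>\<^sub>v col A j) {..<n} $ i = (A *\<^sub>v vec n c) $ i" .
qed

text \<open>With the finite sums over columns written as matrix-vector products, changes of basis become
  matrix algebra.\<close>

lemma fundamental_matrix_iff:
  assumes U: "\<And>x. U x \<in> carrier_mat n n"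
  shows "fundamental_matrix n r U \<longleftrightarrow>
    (\<forall>j<n. solution n r (\<lambda>x. col (U x) j)) \<and>
    (\<forall>c\<in>carrier_vec n. (\<forall>x. U x *\<^sub>v c = 0\<^sub>v n) \<longrightarrow> c = 0\<^sub>v n) \<and>
    (\<forall>v. solution n r v \<longrightarrow> (\<exists>c\<in>carrier_vec n. \<forall>x. v x = U x *\<^sub>v c))"
    (is "_ \<longleftrightarrow> ?sol \<and> ?ind \<and> ?span")
proof -
  have vec_eq: "vec n (\<lambda>i. c $ i) = c" if "c \<in> carrier_vec n" for c :: "complex vec"
    using that by (intro eq_vecI) auto
  have ind: "(\<forall>c. (\<forall>x. U x *\<^sub>v vec n c = 0\<^sub>v n) \<longrightarrow> (\<forall>i\<in>{..<n}. c i = 0)) \<longleftrightarrow> ?ind"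
  proof (intro iffI ballI impI allI)
    fix c :: "complex vec"
    assume *: "\<forall>c. (\<forall>x. U x *\<^sub>v vec n c = 0\<^sub>v n) \<longrightarrow> (\<forall>i\<in>{..<n}. c i = 0)"
      and c: "c \<in> carrier_vec n" and "\<forall>x. U x *\<^sub>v c = 0\<^sub>v n"
    then have "\<forall>i\<in>{..<n}. c $ i = 0" using vec_eq[OF c] by simp
    with c show "c = 0\<^sub>v n" by (intro eq_vecI) auto
  next
    fix c :: "nat \<Rightarrow> complex" and i
    assume *: ?ind and "\<forall>x. U x *\<^sub>v vec n c = 0\<^sub>v n" and i: "i \<in> {..<n}"
    then have "vec n c = 0\<^sub>v n" by (metis vec_carrier)
    then have "vec n c $ i = 0\<^sub>v n $ i" by simp
    with i show "c i = 0" by simp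
  qed
  have span: "(\<exists>c. \<forall>x. v x = U x *\<^sub>v vec n c) \<longleftrightarrow> (\<exists>c\<in>carrier_vec n. \<forall>x. v x = U x *\<^sub>v c)" for v
    using vec_eq vec_carrier by metis
  show ?thesis
    unfolding fundamental_matrix_def fundamental_system_def finsum_vec_cols[OF U] ind span
    using U by auto
qed

lemma fundamental_matrix_mult:
  assumes F: "fundamental_matrix n r U" and r: "r \<in> carrier_mat n n"
    and P: "P \<in> carrier_mat n n" and Q: "Q \<in> carrier_mat n n"
    and PQ: "P * Q = 1\<^sub>m n" and QP: "Q * P = 1\<^sub>m n"
  shows "fundamental_matrix n r (\<lambda>x. U x * P)"
proof -
  have U: "U x \<in> carrier_mat n n" for x using F by (simp add: fundamental_matrix_def)
  have UP: "U x * P \<in> carrier_mat n n" for x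
    by (rule mult_carrier_mat[OF U P])
  note F' = F[unfolded fundamental_matrix_iff[of U, OF U]]
  have sol: "solution n r (\<lambda>x. col (U x) j)" if "j < n" for j
    using F' that by blast
  have ind: "c = 0\<^sub>v n" if "c \<in> carrier_vec n" "\<forall>x. U x *\<^sub>v c = 0\<^sub>v n" for c
    using F' that by blast
  have span: "\<exists>c\<in>carrier_vec n. \<forall>x. v x = U x *\<^sub>v c" if "solution n r v" for v
    using F' that by blast
  have mv: "(U x * P) *\<^sub>v c = U x *\<^sub>v (P *\<^sub>v c)" if "c \<in> carrier_vec n" for c x
    by (rule assoc_mult_mat_vec[OF U P that])
  have QPc: "Q *\<^sub>v (P *\<^sub>v c) = c" if "c \<in> carrier_vec n" for c
    using assoc_mult_mat_vec[OF Q P that] QP that by simp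
  have PQc: "P *\<^sub>v (Q *\<^sub>v c) = c" if "c \<in> carrier_vec n" for c
    using assoc_mult_mat_vec[OF P Q that] PQ that by simp
  show ?thesis
    unfolding fundamental_matrix_iff[of "\<lambda>x. U x * P", OF UP]
  proof (intro conjI allI impI ballI)
    fix j assume j: "j < n"
    have "solution n r (\<lambda>x. U x *\<^sub>v col P j)"
      using solution_mult_mat_vec[OF U sol _ r] P by auto
    then show "solution n r (\<lambda>x. col (U x * P) j)"
      by (simp only: col_mult2[OF U P j])
  next
    fix c :: "complex vec"
    assume c: "c \<in> carrier_vec n" and "\<forall>x. (U x * P) *\<^sub>v c = 0\<^sub>v n"
    then have "P *\<^sub>v c = 0\<^sub>v n" using P by (intro ind) (auto simp: mv)
    then have "Q *\<^sub>v 0\<^sub>v n = c" using QPc[OF c] by simp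
    then show "c = 0\<^sub>v n" using Q by auto
  next
    fix v assume "solution n r v"
    then obtain c where c: "c \<in> carrier_vec n" "\<forall>x. v x = U x *\<^sub>v c" using span by blast
    have Qc: "Q *\<^sub>v c \<in> carrier_vec n" by (rule mult_mat_vec_carrier[OF Q c(1)])
    show "\<exists>c\<in>carrier_vec n. \<forall>x. v x = (U x * P) *\<^sub>v c"
      by (rule bexI[OF _ Qc]) (simp add: mv[OF Qc] PQc[OF c(1)] c(2))
  qed
qed

text \<open>The Jordan structure indexes solutions by pairs (block, position in the block) instead of column
  numbers.\<close>

lemma fundamental_system_reindex:
  assumes h: "bij_betw h I J" and F: "fundamental_system n r J u"
    and v: "\<And>i. i \<in> I \<Longrightarrow> v i = u (h i)"
  shows "fundamental_system n r I v"
proof -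
  have J: "finite J" and sol: "\<And>j. j \<in> J \<Longrightarrow> solution n r (u j)"
    and ind: "\<And>c. \<forall>x. finsum_vec TYPE(complex) n (\<lambda>j. c j \<cdot>\<^sub>v u j x) J = 0\<^sub>v n \<Longrightarrow> \<forall>j\<in>J. c j = 0"
    and span: "\<And>w. solution n r w \<Longrightarrow>
      \<exists>c. \<forall>x. w x = finsum_vec TYPE(complex) n (\<lambda>j. c j \<cdot>\<^sub>v u j x) J"
    using F unfolding fundamental_system_def by blast+
  have I: "finite I" using h J bij_betw_finite by blast
  have hI: "h i \<in> J" if "i \<in> I" for i using h that by (auto simp: bij_betw_def)
  have u: "u j x \<in> carrier_vec n" if "j \<in> J" for j x
    using sol[OF that] by (simp add: solution_def balanced_vec_def)
  have vc: "v i x \<in> carrier_vec n" if "i \<in> I" for i x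
    using u[OF hI[OF that]] v[OF that] by simp
  have eq: "finsum_vec TYPE(complex) n (\<lambda>i. c (h i) \<cdot>\<^sub>v v i x) I
      = finsum_vec TYPE(complex) n (\<lambda>j. c j \<cdot>\<^sub>v u j x) J" for c x
  proof (rule eq_vecI)
    have "finsum_vec TYPE(complex) n (\<lambda>i. c (h i) \<cdot>\<^sub>v v i x) I \<in> carrier_vec n"
      "finsum_vec TYPE(complex) n (\<lambda>j. c j \<cdot>\<^sub>v u j x) J \<in> carrier_vec n"
      by (intro finsum_vec_in_carrier smult_carrier_vec[THEN iffD2] u vc; assumption)+
    note d = this[THEN carrier_vecD]
    show "dim_vec (finsum_vec TYPE(complex) n (\<lambda>i. c (h i) \<cdot>\<^sub>v v i x) I)
      = dim_vec (finsum_vec TYPE(complex) n (\<lambda>j. c j \<cdot>\<^sub>v u j x) J)"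
      by (simp only: d)
    fix m assume "m < dim_vec (finsum_vec TYPE(complex) n (\<lambda>j. c j \<cdot>\<^sub>v u j x) J)"
    then have m: "m < n" by (simp only: d)
    have "finsum_vec TYPE(complex) n (\<lambda>i. c (h i) \<cdot>\<^sub>v v i x) I $ m = (\<Sum>i\<in>I. c (h i) * v i x $ m)"
      by (rule index_finsum_vec_lincomb[OF I vc m])
    also have "\<dots> = (\<Sum>i\<in>I. c (h i) * u (h i) x $ m)"
      by (rule sum.cong) (simp_all add: v)
    also have "\<dots> = (\<Sum>j\<in>J. c j * u j x $ m)"
      by (rule sum.reindex_bij_betw[OF h, of "\<lambda>j. c j * u j x $ m"])
    also have "\<dots> = finsum_vec TYPE(complex) n (\<lambda>j. c j \<cdot>\<^sub>v u j x) J $ m"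
      by (rule index_finsum_vec_lincomb[OF J u m, symmetric])
    finally show "finsum_vec TYPE(complex) n (\<lambda>i. c (h i) \<cdot>\<^sub>v v i x) I $ m
      = finsum_vec TYPE(complex) n (\<lambda>j. c j \<cdot>\<^sub>v u j x) J $ m" .
  qed
  show ?thesis
    unfolding fundamental_system_def
  proof (intro conjI ballI allI impI)
    show "finite I" by (rule I)
    show "solution n r (v i)" if "i \<in> I" for i
      using sol[OF hI[OF that]] v[OF that] by simp
    show "c i = 0" if c: "\<forall>x. finsum_vec TYPE(complex) n (\<lambda>i. c i \<cdot>\<^sub>v v i x) I = 0\<^sub>v n" and i: "i \<in> I"
      for c i
    proof -
      \<comment> \<open>Coefficients are carried over to \<open>J\<close> along the inverse of \<open>h\<close>.\<close>
      define c' where "c' j = c (inv_into I h j)" for j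
      have c': "c' (h i) = c i" if "i \<in> I" for i
        using h that by (simp add: c'_def bij_betw_def)
      have "finsum_vec TYPE(complex) n (\<lambda>i. c' (h i) \<cdot>\<^sub>v v i x) I
        = finsum_vec TYPE(complex) n (\<lambda>i. c i \<cdot>\<^sub>v v i x) I" for x
      proof (rule eq_vecI)
        have "finsum_vec TYPE(complex) n (\<lambda>i. c' (h i) \<cdot>\<^sub>v v i x) I \<in> carrier_vec n"
          "finsum_vec TYPE(complex) n (\<lambda>i. c i \<cdot>\<^sub>v v i x) I \<in> carrier_vec n"
          by (intro finsum_vec_in_carrier smult_carrier_vec[THEN iffD2] u vc; assumption)+
        note d = this[THEN carrier_vecD]
        show "dim_vec (finsum_vec TYPE(complex) n (\<lambda>i. c' (h i) \<cdot>\<^sub>v v i x) I)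
          = dim_vec (finsum_vec TYPE(complex) n (\<lambda>i. c i \<cdot>\<^sub>v v i x) I)"
          by (simp only: d)
        fix m assume "m < dim_vec (finsum_vec TYPE(complex) n (\<lambda>i. c i \<cdot>\<^sub>v v i x) I)"
        then have m: "m < n" by (simp only: d)
        have lincomb: "finsum_vec TYPE(complex) n (\<lambda>i. d i \<cdot>\<^sub>v v i x) I $ m
          = (\<Sum>i\<in>I. d i * v i x $ m)" for d
          by (rule index_finsum_vec_lincomb[OF I vc m])
        show "finsum_vec TYPE(complex) n (\<lambda>i. c' (h i) \<cdot>\<^sub>v v i x) I $ m
          = finsum_vec TYPE(complex) n (\<lambda>i. c i \<cdot>\<^sub>v v i x) I $ m"
          unfolding lincomb by (rule sum.cong) (simp_all add: c')
      qed
      then have "\<forall>x. finsum_vec TYPE(complex) n (\<lambda>j. c' j \<cdot>\<^sub>v u j x) J = 0\<^sub>v n"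
        using c unfolding eq by simp
      from bspec[OF ind[OF this] hI[OF i]] show "c i = 0" by (simp add: c' i)
    qed
    show "\<exists>c. \<forall>x. w x = finsum_vec TYPE(complex) n (\<lambda>i. c i \<cdot>\<^sub>v v i x) I" if "solution n r w" for w
    proof -
      from span[OF that] obtain c
        where "\<forall>x. w x = finsum_vec TYPE(complex) n (\<lambda>j. c j \<cdot>\<^sub>v u j x) J"
        by (rule exE)
      then show ?thesis by (intro exI[of _ "\<lambda>i. c (h i)"]) (simp only: eq simp_thms)
    qed
  qed
qed

section \<open>Columns of a Jordan matrix\<close>

text \<open>Position \<open>l\<close> of block \<open>k\<close> lies in column \<open>\<mu> 0 + \<dots> + \<mu> (k - 1) + l\<close>.\<close>

lemma bij_betw_block_index:
  fixes \<mu> :: "nat \<Rightarrow> nat"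
  shows "bij_betw (\<lambda>(k, l). sum \<mu> {..<k} + l) (SIGMA k:{..<s}. {..<\<mu> k}) {..<sum \<mu> {..<s}}"
proof (induction s)
  case 0
  show ?case by (simp add: bij_betw_def)
next
  case (Suc s)
  let ?h = "\<lambda>(k, l). sum \<mu> {..<k} + l"
  have "bij_betw ?h ({s} \<times> {..<\<mu> s}) {sum \<mu> {..<s}..<sum \<mu> {..<Suc s}}"
    by (rule bij_betw_byWitness[of _ "\<lambda>m. (s, m - sum \<mu> {..<s})"]) auto
  then have "bij_betw ?h ((SIGMA k:{..<s}. {..<\<mu> k}) \<union> {s} \<times> {..<\<mu> s})
    ({..<sum \<mu> {..<s}} \<union> {sum \<mu> {..<s}..<sum \<mu> {..<Suc s}})"
    by (rule bij_betw_combine[OF Suc.IH]) auto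
  moreover have "(SIGMA k:{..<s}. {..<\<mu> k}) \<union> {s} \<times> {..<\<mu> s} = (SIGMA k:{..<Suc s}. {..<\<mu> k})"
    by (auto simp: less_Suc_eq)
  moreover have "{..<sum \<mu> {..<s}} \<union> {sum \<mu> {..<s}..<sum \<mu> {..<Suc s}} = {..<sum \<mu> {..<Suc s}}"
    by auto
  ultimately show ?case by simp
qed

lemma jordan_matrix_index:
  assumes "k < length bs" "bs ! k = (m, a)" "l < m" "i < sum_list (map fst bs)"
    "c = (\<Sum>j<k. fst (bs ! j)) + l"
  shows "jordan_matrix bs $$ (i, c) = (if i = c then a else if l > 0 \<and> Suc i = c then 1 else (0::complex))"
  using assms
proof (induction bs arbitrary: k i c)
  case Nil
  then show ?case by simp
next
  case (Cons b bs)
  obtain n0 a0 where b: "b = (n0, a0)" by force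
  show ?case
  proof (cases k)
    case 0
    with Cons.prems b show ?thesis
      by (auto simp: jordan_matrix_Cons jordan_block_def index_mat_four_block)
  next
    case (Suc k')
    define c' where "c' = (\<Sum>j<k'. fst (bs ! j)) + l"
    have k': "k' < length bs" "bs ! k' = (m, a)" using Cons.prems Suc by auto
    have c: "c = n0 + c'"
      using Cons.prems(5) unfolding Suc sum.lessThan_Suc_shift b c'_def by simp
    have "c' < (\<Sum>j<Suc k'. fst (bs ! j))" using k' Cons.prems(3) by (simp add: c'_def)
    also have "\<dots> \<le> (\<Sum>j<length bs. fst (bs ! j))"
      using k' by (intro sum_mono2) auto
    also have "\<dots> = sum_list (map fst bs)"
      by (simp add: sum_list_sum_nth atLeast0LessThan)
    finally have c'_less: "c' < sum_list (map fst bs)" .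
    show ?thesis
    proof (cases "i < n0")
      case True
      have "l = 0" if "Suc i = c" using that True c c'_def by simp
      with True show ?thesis
        using c c'_less Cons.prems(4) by (auto simp: b jordan_matrix_Cons index_mat_four_block)
    next
      case False
      then have i: "i - n0 < sum_list (map fst bs)" using Cons.prems(4) b by simp
      have "jordan_matrix (b # bs) $$ (i, c) = jordan_matrix bs $$ (i - n0, c')"
        using False c c'_less i by (simp add: b jordan_matrix_Cons index_mat_four_block)
      also have "\<dots> = (if i - n0 = c' then a else if l > 0 \<and> Suc (i - n0) = c' then 1 else 0)"
        by (rule Cons.IH[OF k' Cons.prems(3) i c'_def])
      also have "\<dots> = (if i = c then a else if l > 0 \<and> Suc i = c then 1 else 0)"
        using False c by auto
      finally show ?thesis .
    qed
  qed
qed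

text \<open>The off-diagonal term involves the preceding column, which lies in the same block unless \<open>l = 0\<close>.\<close>

lemma mult_jordan_matrix_index:
  fixes V :: "complex mat"
  assumes V: "V \<in> carrier_mat n n" and n: "n = sum_list (map fst bs)" and i: "i < n"
    and k: "k < length bs" "bs ! k = (m, a)" "l < m"
    and c: "c = (\<Sum>j<k. fst (bs ! j)) + l" "c < n"
  shows "(V * jordan_matrix bs) $$ (i, c) = a * V $$ (i, c) + (if l = 0 then 0 else V $$ (i, c - 1))"
proof -
  have J: "jordan_matrix bs \<in> carrier_mat n n" unfolding n by simp
  have "(V * jordan_matrix bs) $$ (i, c) = (\<Sum>j<n. V $$ (i, j) * jordan_matrix bs $$ (j, c))"
    using carrier_matD[OF V] carrier_matD[OF J] i c(2)
    by (simp add: scalar_prod_def atLeast0LessThan del: jordan_matrix_dim)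
  also have "\<dots> = (\<Sum>j<n. (if j = c then a * V $$ (i, j) else 0)
      + (if j = c - 1 then (if l = 0 then 0 else V $$ (i, j)) else 0))"
  proof (rule sum.cong)
    fix j assume "j \<in> {..<n}"
    then have j: "j < sum_list (map fst bs)" using n by simp
    have "0 < c" if "0 < l" using that c(1) by simp
    then show "V $$ (i, j) * jordan_matrix bs $$ (j, c)
      = (if j = c then a * V $$ (i, j) else 0)
        + (if j = c - 1 then (if l = 0 then 0 else V $$ (i, j)) else 0)"
      unfolding jordan_matrix_index[OF k j c(1)] by (cases "l = 0") auto
  qed simp
  also have "\<dots> = a * V $$ (i, c) + (if l = 0 then 0 else V $$ (i, c - 1))"
    using c(2) by (simp add: sum.distrib)
  finally show ?thesis .
qed

section \<open>The polynomial factors and the periodic factors\<close>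

text \<open>The closed form is \<open>floquet_q \<omega> \<rho> j x = ((x / \<omega>) gchoose j) / \<rho> ^ j\<close>, and the lemma is Pascal's rule
  for generalised binomial coefficients.\<close>

lemma floquet_q_shift:
  assumes "\<omega> \<noteq> 0" "\<rho> \<noteq> 0"
  shows "floquet_q \<omega> \<rho> (Suc j) (x + \<omega>) = floquet_q \<omega> \<rho> (Suc j) x + floquet_q \<omega> \<rho> j x / \<rho>"
proof (induction j)
  case 0
  show ?case using assms by (simp add: field_simps)
next
  case (Suc j)
  let ?q = "floquet_q \<omega> \<rho> j x" and ?w = "of_real \<omega> :: complex" and ?x = "of_real x :: complex"
  let ?j = "of_nat j :: complex"
  have nz: "1 + ?j \<noteq> 0" "2 + ?j \<noteq> 0"
    using of_nat_neq_0[of j, where 'a=complex] of_nat_neq_0[of "Suc j", where 'a=complex]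
    by (simp_all add: add_ac)
  have "floquet_q \<omega> \<rho> (Suc (Suc j)) (x + \<omega>)
    = (?q * ((?x - ?j * ?w) / ((1 + ?j) * \<rho> * ?w)) + ?q / \<rho>)
      * ((?x - ?j * ?w) / ((2 + ?j) * \<rho> * ?w))"
    unfolding floquet_q.simps(2)[of _ _ "Suc j"] Suc.IH
    by (simp add: algebra_simps)
  also have "\<dots> = ?q * ((?x - ?j * ?w) / ((1 + ?j) * \<rho> * ?w))
        * ((?x - (1 + ?j) * ?w) / ((2 + ?j) * \<rho> * ?w))
      + ?q * ((?x - ?j * ?w) / ((1 + ?j) * \<rho> * ?w)) / \<rho>"
    using assms nz by (simp add: divide_simps) (simp add: algebra_simps)
  also have "\<dots> = floquet_q \<omega> \<rho> (Suc (Suc j)) x + floquet_q \<omega> \<rho> (Suc j) x / \<rho>"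
    by (simp add: algebra_simps)
  finally show ?case .
qed

lemma has_vector_derivative_exp_of_real:
  "((\<lambda>x. exp (a * of_real x) :: complex) has_vector_derivative a * exp (a * of_real x)) (at x)"
proof -
  have "((\<lambda>z. exp (a * z)) has_field_derivative a * exp (a * of_real x)) (at (of_real x))"
    by (auto intro!: derivative_eq_intros)
  from has_vector_derivative_real_field[OF this] show ?thesis .
qed

lemma exp_continuous_bv:
  fixes a :: complex
  shows "continuous_on UNIV (\<lambda>x::real. exp (a * of_real x))" "locally_bv (\<lambda>x::real. exp (a * of_real x))"
proof -
  show "continuous_on UNIV (\<lambda>x::real. exp (a * of_real x))"
    by (intro continuous_intros)
  show "locally_bv (\<lambda>x::real. exp (a * of_real x))"
    by (rule locally_bv_C1[OF has_vector_derivative_exp_of_real]) (intro continuous_intros)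
qed

lemma floquet_q_continuous_bv:
  "continuous_on UNIV (floquet_q \<omega> \<rho> j) \<and> locally_bv (floquet_q \<omega> \<rho> j)"
proof (induction j)
  case 0
  have "floquet_q \<omega> \<rho> 0 = (\<lambda>x. 1)" by (rule ext) simp
  then show ?case by (simp add: locally_bv_const)
next
  case (Suc j)
  define d where "d = of_nat (j + 1) * \<rho> * of_real \<omega>"
  define g :: "real \<Rightarrow> complex" where "g x = of_real (x - of_nat j * \<omega>) * inverse d" for x
  have q: "floquet_q \<omega> \<rho> (Suc j) = (\<lambda>x. floquet_q \<omega> \<rho> j x * g x)"
    by (rule ext) (simp add: g_def d_def divide_inverse)
  have "continuous_on UNIV g" unfolding g_def by (intro continuous_intros)
  moreover have "locally_bv g"
  proof (rule locally_bv_C1)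
    show "(g has_vector_derivative inverse d) (at x)" for x
      unfolding g_def by (auto intro!: derivative_eq_intros)
  qed simp
  ultimately show ?case
    using Suc.IH unfolding q by (simp add: locally_bv_mult continuous_on_mult)
qed

text \<open>The periodic factors belonging to one Jordan block, for one component of the solutions: \<open>v l\<close> is that
  component of the \<open>l\<close>-th column of the block. The recursion solves
  \<open>v l x = exp (\<alpha> x) (\<Sum>j\<le>l. floquet_q \<omega> \<rho> j x * p (l - j) x)\<close> for the term \<open>p l x\<close> with
  \<open>j = 0\<close>; the summation index \<open>j\<close> below is the index of \<open>p\<close>.\<close>

function floquet_p ::
  "real \<Rightarrow> complex \<Rightarrow> complex \<Rightarrow> (nat \<Rightarrow> real \<Rightarrow> complex) \<Rightarrow> nat \<Rightarrow> real \<Rightarrow> complex" where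
  "floquet_p \<omega> \<rho> \<alpha> v l x = exp (- \<alpha> * of_real x) * v l x
     - (\<Sum>j<l. floquet_q \<omega> \<rho> (l - j) x * floquet_p \<omega> \<rho> \<alpha> v j x)"
  by auto
termination by (relation "Wellfounded.measure (\<lambda>(\<omega>, \<rho>, \<alpha>, v, l, x). l)") auto

declare floquet_p.simps [simp del]

lemma sum_floquet_q_p:
  "(\<Sum>j=0..l. floquet_q \<omega> \<rho> j x * floquet_p \<omega> \<rho> \<alpha> v (l - j) x) = exp (- \<alpha> * of_real x) * v l x"
proof -
  have "(\<Sum>j=0..l. floquet_q \<omega> \<rho> j x * floquet_p \<omega> \<rho> \<alpha> v (l - j) x)
    = (\<Sum>j=0..l. floquet_q \<omega> \<rho> (l - j) x * floquet_p \<omega> \<rho> \<alpha> v j x)"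
    by (subst sum.atLeastAtMost_rev) (auto intro!: sum.cong)
  also have "\<dots> = floquet_p \<omega> \<rho> \<alpha> v l x + (\<Sum>j<l. floquet_q \<omega> \<rho> (l - j) x * floquet_p \<omega> \<rho> \<alpha> v j x)"
    by (simp add: atLeast0AtMost lessThan_Suc_atMost[symmetric])
  also have "\<dots> = exp (- \<alpha> * of_real x) * v l x"
    by (subst floquet_p.simps) simp
  finally show ?thesis .
qed

text \<open>After division by \<open>exp (\<alpha> x)\<close> the functions \<open>v l\<close> and the polynomials \<open>floquet_q \<omega> \<rho> l\<close> obey the same
  law under \<open>x \<mapsto> x + \<omega>\<close>: the function with index \<open>l - 1\<close>, divided by \<open>\<rho>\<close>, is added. So the
  increments of the two terms in the definition of \<open>floquet_p\<close> cancel.\<close>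

lemma floquet_p_periodic:
  assumes \<omega>: "\<omega> \<noteq> 0" and \<alpha>: "exp (\<alpha> * of_real \<omega>) = \<rho>"
    and v: "\<And>l x. l < m \<Longrightarrow> v l (x + \<omega>) = \<rho> * v l x + (if l = 0 then 0 else v (l - 1) x)"
  shows "l < m \<Longrightarrow> floquet_p \<omega> \<rho> \<alpha> v l (x + \<omega>) = floquet_p \<omega> \<rho> \<alpha> v l x"
proof (induction l rule: less_induct)
  case (less l)
  let ?p = "\<lambda>j. floquet_p \<omega> \<rho> \<alpha> v j x" and ?q = "\<lambda>j. floquet_q \<omega> \<rho> j x"
  let ?e = "exp (- \<alpha> * of_real x)"
  have \<rho>: "\<rho> \<noteq> 0" using \<alpha> by auto
  have e: "exp (- \<alpha> * of_real (x + \<omega>)) = ?e / \<rho>"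
    by (simp add: exp_minus exp_diff \<alpha>[symmetric] distrib_left divide_inverse)
  have "(\<Sum>j<l. floquet_q \<omega> \<rho> (l - j) (x + \<omega>) * floquet_p \<omega> \<rho> \<alpha> v j (x + \<omega>))
    = (\<Sum>j<l. ?q (l - j) * ?p j + ?q (l - 1 - j) * ?p j / \<rho>)"
  proof (rule sum.cong)
    fix j assume "j \<in> {..<l}"
    then have j: "j < l" "l - j = Suc (l - 1 - j)" by auto
    with less have "floquet_p \<omega> \<rho> \<alpha> v j (x + \<omega>) = ?p j" by simp
    then show "floquet_q \<omega> \<rho> (l - j) (x + \<omega>) * floquet_p \<omega> \<rho> \<alpha> v j (x + \<omega>)
      = ?q (l - j) * ?p j + ?q (l - 1 - j) * ?p j / \<rho>"
      unfolding j(2) floquet_q_shift[OF \<omega> \<rho>] by (simp only: distrib_right times_divide_eq_left)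
  qed simp
  also have "\<dots> = (\<Sum>j<l. ?q (l - j) * ?p j) + (\<Sum>j<l. ?q (l - 1 - j) * ?p j) / \<rho>"
    by (simp add: sum.distrib sum_divide_distrib)
  also have "(\<Sum>j<l. ?q (l - 1 - j) * ?p j) = (if l = 0 then 0 else ?e * v (l - 1) x)"
  proof (cases l)
    case (Suc l')
    have "(\<Sum>j<l. ?q (l - 1 - j) * ?p j) = (\<Sum>j=0..l'. ?q (l' - j) * ?p j)"
      by (simp add: Suc atLeast0AtMost lessThan_Suc_atMost)
    also have "\<dots> = (\<Sum>j=0..l'. ?q j * ?p (l' - j))"
      by (subst sum.atLeastAtMost_rev) (auto intro!: sum.cong)
    finally show ?thesis using Suc by (simp add: sum_floquet_q_p)
  qed simp
  finally have "floquet_p \<omega> \<rho> \<alpha> v l (x + \<omega>)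
    = ?e / \<rho> * (\<rho> * v l x + (if l = 0 then 0 else v (l - 1) x))
      - ((\<Sum>j<l. ?q (l - j) * ?p j) + (if l = 0 then 0 else ?e * v (l - 1) x) / \<rho>)"
    by (subst floquet_p.simps) (simp only: e v[OF less.prems])
  also have "\<dots> = ?e * v l x - (\<Sum>j<l. ?q (l - j) * ?p j)"
    using \<rho> by (simp add: field_simps)
  also have "\<dots> = ?p l"
    by (subst floquet_p.simps) simp
  finally show ?case .
qed

lemma floquet_p_balanced:
  assumes v: "\<And>l. l < m \<Longrightarrow> balanced (v l)"
  shows "l < m \<Longrightarrow> balanced (floquet_p \<omega> \<rho> \<alpha> v l)"
proof (induction l rule: less_induct)
  case (less l)
  have eq: "floquet_p \<omega> \<rho> \<alpha> v l = (\<lambda>x. exp (- \<alpha> * of_real x) * v l x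
     - (\<Sum>j<l. floquet_q \<omega> \<rho> (l - j) x * floquet_p \<omega> \<rho> \<alpha> v j x))"
    by (rule ext) (rule floquet_p.simps)
  show ?case
    unfolding eq
  proof (intro balanced_diff balanced_sum)
    show "balanced (\<lambda>x. exp (- \<alpha> * of_real x) * v l x)"
      using less.prems by (intro balanced_mult_continuous exp_continuous_bv v)
    fix j assume "j \<in> {..<l}"
    then show "balanced (\<lambda>x. floquet_q \<omega> \<rho> (l - j) x * floquet_p \<omega> \<rho> \<alpha> v j x)"
      using less floquet_q_continuous_bv[of \<omega> \<rho> "l - j"]
      by (intro balanced_mult_continuous) auto
  qed
qed

section \<open>The fundamental system\<close>

theorem theorem3p3:
  fixes n :: nat and \<omega> :: real and r :: "functional mat"
    and M :: "complex mat" and blocks :: "(nat \<times> complex) list"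
    and s :: nat and \<mu> :: "nat \<Rightarrow> nat" and \<rho> :: "nat \<Rightarrow> complex"
  assumes "\<omega> > 0"
    and "r \<in> carrier_mat n n"
    and "\<forall>i<n. \<forall>j<n. distribution_order0 (r $$ (i, j)) \<and> periodic_distribution \<omega> (r $$ (i, j))"
    and "\<forall>x. invertible_mat (1\<^sub>m n + (1 / 2) \<cdot>\<^sub>m \<Delta> r x) \<and>
             invertible_mat (1\<^sub>m n - (1 / 2) \<cdot>\<^sub>m \<Delta> r x)"
    and "monodromy_matrix n r \<omega> M"
    and "jordan_nf M blocks"
    and "s = length blocks"
    and "\<forall>k<s. blocks ! k = (\<mu> k, \<rho> k)"
  shows "(\<Sum>k<s. \<mu> k) = n \<and> (\<forall>k<s. \<rho> k \<noteq> 0) \<and>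
    (\<forall>\<alpha> :: nat \<Rightarrow> complex. (\<forall>k<s. exp (\<alpha> k * of_real \<omega>) = \<rho> k) \<longrightarrow>
       (\<exists>p :: nat \<Rightarrow> nat \<Rightarrow> real \<Rightarrow> complex vec.
          (\<forall>k<s. \<forall>j<\<mu> k. balanced_vec n (p k j) \<and> (\<forall>x. p k j (x + \<omega>) = p k j x)) \<and>
          fundamental_system n r (SIGMA k:{..<s}. {..<\<mu> k})
            (\<lambda>(k, l) x. exp (\<alpha> k * of_real x) \<cdot>\<^sub>v
               finsum_vec TYPE(complex) n
                 (\<lambda>j. floquet_q \<omega> (\<rho> k) j x \<cdot>\<^sub>v p k (l - j) x) {0..l})))"
proof -
  let ?J = "jordan_matrix blocks"
  define off where "off k = sum \<mu> {..<k}" for k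
  obtain U where M: "M \<in> carrier_mat n n" and U_fund: "fundamental_matrix n r U"
    and U_per: "\<And>x. U (x + \<omega>) = U x * M"
    using assms(5) unfolding monodromy_matrix_def by blast
  have U: "U x \<in> carrier_mat n n" for x using U_fund by (simp add: fundamental_matrix_def)
  obtain P Q where PQ: "similar_mat_wit M ?J P Q"
    using assms(6) unfolding jordan_nf_def similar_mat_def by blast
  note wit = similar_mat_witD2[OF M PQ]
  have blk: "blocks ! k = (\<mu> k, \<rho> k)" "k < length blocks" if "k < s" for k
    using assms(7,8) that by auto
  have off_blocks: "off k = (\<Sum>j<k. fst (blocks ! j))" if "k < s" for k
    unfolding off_def using that blk by (intro sum.cong) auto
  have n: "n = sum_list (map fst blocks)" using wit(5) by (metis carrier_matD(1) jordan_matrix_dim(1))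
  have sum_n: "sum \<mu> {..<s} = n"
    unfolding n sum_list_sum_nth using blk by (intro sum.cong) (auto simp: assms(7))
  have bij: "bij_betw (\<lambda>(k, l). off k + l) (SIGMA k:{..<s}. {..<\<mu> k}) {..<n}"
    using bij_betw_block_index[of \<mu> s] unfolding off_def sum_n .
  have off_less: "off k + l < n" if "k < s" "l < \<mu> k" for k l
    using bij that unfolding bij_betw_def by auto

  \<comment> \<open>In the basis given by the columns of \<open>V\<close> the monodromy matrix is in Jordan form.\<close>
  define V where "V x = U x * P" for x
  have V: "V x \<in> carrier_mat n n" for x
    unfolding V_def by (rule mult_carrier_mat[OF U wit(6)])
  have V_fund: "fundamental_matrix n r V"
    unfolding V_def by (rule fundamental_matrix_mult[OF U_fund assms(2) wit(6,7,1,2)])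
  have V_per: "V (x + \<omega>) = V x * ?J" for x
  proof -
    have "V (x + \<omega>) = U x * (P * ?J * Q) * P"
      unfolding V_def U_per wit(3) ..
    also have "\<dots> = U x * P * ?J * (Q * P)"
      using U[of x] wit(5-7) by (simp add: assoc_mult_mat[of _ n n _ n _ n])
    also have "\<dots> = V x * ?J" 
      unfolding V_def[symmetric] wit(2) by (rule right_mult_one_mat[OF mult_carrier_mat[OF V wit(5)]])
    finally show ?thesis .
  qed
  have V_shift: "V (x + \<omega>) $$ (i, off k + l)
      = \<rho> k * V x $$ (i, off k + l) + (if l = 0 then 0 else V x $$ (i, off k + (l - 1)))"
    if "i < n" "k < s" "l < \<mu> k" for i k l x
    using mult_jordan_matrix_index[OF V n that(1) blk(2)[OF that(2)] blk(1)[OF that(2)] that(3) refl]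
      off_less[OF that(2,3)] off_blocks[OF that(2)]
    unfolding V_per by auto
  note V_fund' = V_fund[unfolded fundamental_matrix_iff[of V, OF V]]
  have V_sol: "solution n r (\<lambda>x. col (V x) j)" if "j < n" for j
    using V_fund' that by blast
  have V_ind: "c = 0\<^sub>v n" if "c \<in> carrier_vec n" "\<forall>x. V x *\<^sub>v c = 0\<^sub>v n" for c
    using V_fund' that by blast
  have V_bal: "balanced (\<lambda>x. V x $$ (i, j))" if "i < n" "j < n" for i j
    using V_sol[OF that(2)] that V[THEN carrier_matD(1)] V[THEN carrier_matD(2)]
    by (simp add: solution_def balanced_vec_def)

  \<comment> \<open>A zero eigenvalue would make the first column of its block vanish identically.\<close>
  have rho: "\<rho> k \<noteq> 0" if k: "k < s" for k
  proof
    assume zero: "\<rho> k = 0"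
    have "\<mu> k \<noteq> 0"
      using assms(6) blk[OF k] unfolding jordan_nf_def by (metis fst_conv image_eqI nth_mem)
    then have l: "0 < \<mu> k" by simp
    let ?c = "unit_vec n (off k) :: complex vec"
    have k': "off k < n" using off_less[OF k l] by simp
    have "V x *\<^sub>v ?c = 0\<^sub>v n" for x
    proof (rule eq_vecI)
      fix i assume "i < dim_vec (0\<^sub>v n :: complex vec)"
      then have i: "i < n" by simp
      have "V x $$ (i, off k) = 0"
        using V_shift[OF i k l, of "x - \<omega>"] zero by simp
      then show "(V x *\<^sub>v ?c) $ i = 0\<^sub>v n $ i"
        using i k' V[of x] by (simp add: scalar_prod_right_unit)
    qed (use V[of x] in simp)
    then have "?c = 0\<^sub>v n" by (intro V_ind) auto
    then have "?c $ off k = 0\<^sub>v n $ off k" by simp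
    with k' show False by simp
  qed

  have "\<exists>p :: nat \<Rightarrow> nat \<Rightarrow> real \<Rightarrow> complex vec.
      (\<forall>k<s. \<forall>j<\<mu> k. balanced_vec n (p k j) \<and> (\<forall>x. p k j (x + \<omega>) = p k j x)) \<and>
      fundamental_system n r (SIGMA k:{..<s}. {..<\<mu> k})
        (\<lambda>(k, l) x. exp (\<alpha> k * of_real x) \<cdot>\<^sub>v
           finsum_vec TYPE(complex) n
             (\<lambda>j. floquet_q \<omega> (\<rho> k) j x \<cdot>\<^sub>v p k (l - j) x) {0..l})"
    if \<alpha>: "\<forall>k<s. exp (\<alpha> k * of_real \<omega>) = \<rho> k" for \<alpha> :: "nat \<Rightarrow> complex"
  proof -
    define v where "v k i l x = V x $$ (i, off k + l)" for k i l x
    define p where "p k j x = vec n (\<lambda>i. floquet_p \<omega> (\<rho> k) (\<alpha> k) (v k i) j x)" for k j x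
    have v_shift: "v k i l (x + \<omega>) = \<rho> k * v k i l x + (if l = 0 then 0 else v k i (l - 1) x)"
      if "i < n" "k < s" "l < \<mu> k" for i k l x
      unfolding v_def by (rule V_shift[OF that])
    have p_bal: "balanced_vec n (p k j)" if "k < s" "j < \<mu> k" for k j
      unfolding balanced_vec_def
    proof (intro conjI allI impI)
      show "p k j x \<in> carrier_vec n" for x by (simp add: p_def)
      fix i assume i: "i < n"
      have "balanced (v k i l)" if "l < \<mu> k" for l
        unfolding v_def by (rule V_bal[OF i off_less[OF \<open>k < s\<close> that]])
      from floquet_p_balanced[OF this that(2)]
      show "balanced (\<lambda>x. p k j x $ i)" using i by (simp add: p_def)
    qed
    have p_per: "p k j (x + \<omega>) = p k j x" if "k < s" "j < \<mu> k" for k j x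
    proof (rule eq_vecI)
      fix i assume "i < dim_vec (p k j x)"
      then have i: "i < n" by (simp add: p_def)
      have "floquet_p \<omega> (\<rho> k) (\<alpha> k) (v k i) j (x + \<omega>) = floquet_p \<omega> (\<rho> k) (\<alpha> k) (v k i) j x"
        by (rule floquet_p_periodic[where m="\<mu> k"])
          (use assms(1) \<alpha> that i v_shift in auto)
      with i show "p k j (x + \<omega>) $ i = p k j x $ i" by (simp add: p_def)
    qed (simp add: p_def)
    have sum_eq: "exp (\<alpha> k * of_real x) \<cdot>\<^sub>v
           finsum_vec TYPE(complex) n (\<lambda>j. floquet_q \<omega> (\<rho> k) j x \<cdot>\<^sub>v p k (l - j) x) {0..l}
        = col (V x) (off k + l)" (is "?a \<cdot>\<^sub>v ?f = _") if "k < s" "l < \<mu> k" for k l x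
    proof (rule eq_vecI)
      have pc: "p k j x \<in> carrier_vec n" for j by (simp add: p_def)
      have f: "?f \<in> carrier_vec n" by (intro finsum_vec_in_carrier smult_carrier_vec[THEN iffD2] pc)
      show "dim_vec (?a \<cdot>\<^sub>v ?f) = dim_vec (col (V x) (off k + l))"
        using carrier_vecD[OF f] V[of x] by simp
      fix i assume "i < dim_vec (col (V x) (off k + l))"
      then have i: "i < n" using V[of x] by simp
      have "?f $ i = (\<Sum>j=0..l. floquet_q \<omega> (\<rho> k) j x * p k (l - j) x $ i)"
        by (rule index_finsum_vec_lincomb[OF _ pc i]) simp
      also have "\<dots> = exp (- \<alpha> k * of_real x) * v k i l x"
        using i by (simp add: p_def sum_floquet_q_p)
      finally have "(?a \<cdot>\<^sub>v ?f) $ i = ?a * (exp (- \<alpha> k * of_real x) * v k i l x)"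
        using i carrier_vecD[OF f] by simp
      also have "\<dots> = v k i l x"
        by (simp add: exp_minus)
      finally show "(?a \<cdot>\<^sub>v ?f) $ i = col (V x) (off k + l) $ i"
        using i V[of x] off_less[OF that] by (simp add: v_def)
    qed
    have "fundamental_system n r (SIGMA k:{..<s}. {..<\<mu> k})
        (\<lambda>(k, l) x. exp (\<alpha> k * of_real x) \<cdot>\<^sub>v
           finsum_vec TYPE(complex) n (\<lambda>j. floquet_q \<omega> (\<rho> k) j x \<cdot>\<^sub>v p k (l - j) x) {0..l})"
    proof (rule fundamental_system_reindex[OF bij])
      show "fundamental_system n r {..<n} (\<lambda>j x. col (V x) j)"
        using V_fund by (simp add: fundamental_matrix_def)
    qed (use sum_eq in \<open>auto simp: fun_eq_iff\<close>)
    with p_bal p_per show ?thesis by (intro exI[of _ p]) blast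
  qed
  with sum_n rho show ?thesis by blast
qed

end
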